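(* For every $n\in\mathbb Z_{>0}$, the normally ordered $n$-wedges $G(c_1)\wedge G(c_2)\wedge\cdots\wedge G(c_n)$, where $(c_1,\dots,c_n)\in B_{\mathrm{aff}}^n$ satisfies $H(c_r\otimes c_{r+1})>0$ for all $1\le r\le n-1$, form a basis of the $\mathbb Q(q)$-vector space $\bigwedge^nV_{\mathrm{aff}}$.
   Context: Let $\mathfrak g=\widehat{\mathfrak{sl}}_2$, $I=\{0,1\}$, weight lattice $P=\mathbb Z\Lambda_0\oplus\mathbb Z\Lambda_1\oplus\mathbb Z\delta$, coroots $h_0,h_1$ with $\langle h_i,\Lambda_j\rangle=\delta_{ij}$, $\langle h_i,\delta\rangle=0$, central element $c=h_0+h_1$. $U_q(\mathfrak g)$ is the quantum affine algebra over $\mathbb Q(q)$ with generators $e_i,f_i$ ($i\in I$), $q^h$ ($h\in P^*$), $t_i=q^{h_i}$, and coproduct $\Delta(q^h)=q^h\otimes q^h$, $\Delta(e_i)=e_i\otimes1+t_i^{-1}\otimes e_i$, $\Delta(f_i)=f_i\otimes t_i+1\otimes f_i$. $[n]=(q^n-q^{-n})/(q-q^{-1})$. Let $J=\{0,1,2\}$. $V_{\mathrm{aff}}$ is the $\mathbb Q(q)$-space with basis $z^av_j$ ($a\in\mathbb Z$, $j\in J$), a $U_q(\mathfrak g)$-module via: $\mathrm{wt}(z^av_j)=2(1-j)(\Lambda_1-\Lambda_0)+a\delta$, $q^hz^av_j=q^{\langle h,\mathrm{wt}(z^av_j)\rangle}z^av_j$, $e_1z^av_j=[3-j]z^av_{j-1}$,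 $f_1z^av_j=[j+1]z^av_{j+1}$, $e_0z^av_j=[j+1]z^{a+1}v_{j+1}$, $f_0z^av_j=[3-j]z^{a-1}v_{j-1}$ (with $v_{-1}=v_3=0$). The operator $z^b$ sends $z^av_j\mapsto z^{a+b}v_j$. The crystal of $V_{\mathrm{aff}}$ is $B_{\mathrm{aff}}=\{z^ab_j\}$ with lower global base $G(z^ab_j)=z^av_j$; the energy function is $H(z^ab_i\otimes z^{a'}b_j)=\min\{i,2-j\}-a+a'$. $N\subset V_{\mathrm{aff}}\otimes V_{\mathrm{aff}}$ is the smallest subspace containing $v_0\otimes v_0$ that is stable under the action of $U_q(\mathfrak g)$ (via $\Delta$) and under the operators $z\otimes z$, $z^{-1}\otimes z^{-1}$, $z\otimes1+1\otimes z$. For $n\ge2$, $N_n=\sum_{r=0}^{n-2}V_{\mathrm{aff}}^{\otimes r}\otimes N\otimes V_{\mathrm{aff}}^{\otimes(n-r-2)}$ and $\bigwedge^nV_{\mathrm{aff}}:=V_{\mathrm{aff}}^{\otimes n}/N_n$ (a $U_q(\mathfrak g)$-module); $\bigwedge^1V_{\mathrm{aff}}=V_{\mathrm{aff}}$; $u_1\wedge\cdots\wedge u_n$ is the image of $u_1\otimes\cdots\otimes u_n$. *)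

theory Defs
  imports "HOL-Computational_Algebra.Computational_Algebra"
begin

type_synonym K = "rat poly fract"

definition qq :: K where "qq = Fract [:0, 1:] 1"

definition qint :: "nat \<Rightarrow> K" where
  "qint n = (qq ^ n - inverse qq ^ n) / (qq - inverse qq)"

text \<open>Crystal / basis labels: (a, j) stands for z^a v_j (resp. z^a b_j), j in J = {0,1,2}.
  A basis vector of the n-fold tensor power is a list of length n of such labels.
  Vectors of tensor powers are finitely supported coefficient functions on lists.\<close>
type_synonym bas = "int \<times> nat"
type_synonym vec = "bas list \<Rightarrow> K"

definition valid :: "bas list \<Rightarrow> bool" where
  "valid L \<longleftrightarrow> (\<forall>b\<in>set L. snd b \<le> 2)"

definition Tn :: "nat \<Rightarrow> vec set" where
  "Tn n = {f. finite {L. f L \<noteq> 0} \<and> (\<forall>L. f L \<noteq> 0 \<longrightarrow> length L = n \<and> valid L)}"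

definition delta :: "bas list \<Rightarrow> vec" where
  "delta L = (\<lambda>M. if M = L then 1 else 0)"

definition lin :: "(bas list \<Rightarrow> vec) \<Rightarrow> vec \<Rightarrow> vec" where
  "lin g f = (\<lambda>M. \<Sum>L\<in>{L. f L \<noteq> 0}. f L * g L M)"

text \<open>Pairing of h_i with wt(z^a v_j) = 2(1-j)(Lambda_1 - Lambda_0) + a delta.\<close>
definition hw :: "nat \<Rightarrow> nat \<Rightarrow> int" where
  "hw i j = (if i = 0 then 2 * int j - 2 else 2 - 2 * int j)"

definition tq :: "nat \<Rightarrow> bas \<Rightarrow> K" where
  "tq i b = qq powi (hw i (snd b))"

text \<open>Matrix coefficients on V_aff: ecoef i b b' is the coefficient of b' in e_i b.\<close>
definition ecoef :: "nat \<Rightarrow> bas \<Rightarrow> bas \<Rightarrow> K" where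
  "ecoef i b b' = (case b of (a, j) \<Rightarrow>
     if i = 0 then (if j \<le> 1 \<and> b' = (a + 1, j + 1) then qint (j + 1) else 0)
     else (if 1 \<le> j \<and> b' = (a, j - 1) then qint (3 - j) else 0))"

definition fcoef :: "nat \<Rightarrow> bas \<Rightarrow> bas \<Rightarrow> K" where
  "fcoef i b b' = (case b of (a, j) \<Rightarrow>
     if i = 0 then (if 1 \<le> j \<and> b' = (a - 1, j - 1) then qint (3 - j) else 0)
     else (if j \<le> 1 \<and> b' = (a, j + 1) then qint (j + 1) else 0))"

definition replace_at :: "bas list \<Rightarrow> nat \<Rightarrow> (bas \<Rightarrow> K) \<Rightarrow> vec" where
  "replace_at L r v = (\<lambda>M. if length M = length L \<and> (\<forall>s<length L. s \<noteq> r \<longrightarrow> M ! s = L ! s)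
                            then v (M ! r) else 0)"

text \<open>Iterated coproduct: Delta(e_i) = e_i (x) 1 + t_i^{-1} (x) e_i,
  Delta(f_i) = f_i (x) t_i + 1 (x) f_i, Delta(q^h) = q^h (x) q^h.\<close>
definition eT :: "nat \<Rightarrow> bas list \<Rightarrow> vec" where
  "eT i L = (\<lambda>M. \<Sum>r<length L. (\<Prod>s<r. inverse (tq i (L ! s))) * replace_at L r (ecoef i (L ! r)) M)"

definition fT :: "nat \<Rightarrow> bas list \<Rightarrow> vec" where
  "fT i L = (\<lambda>M. \<Sum>r<length L. (\<Prod>s\<in>{r<..<length L}. tq i (L ! s)) * replace_at L r (fcoef i (L ! r)) M)"

text \<open>q^h for h = m0 h_0 + m1 h_1 + m d in P^* (d dual to delta).\<close>
definition qhT :: "int \<times> int \<times> int \<Rightarrow> bas list \<Rightarrow> vec" where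
  "qhT h L = (case h of (m0, m1, m) \<Rightarrow>
     (\<lambda>M. if M = L then qq powi (\<Sum>s<length L. m0 * hw 0 (snd (L ! s)) + m1 * hw 1 (snd (L ! s)) + m * fst (L ! s))
          else 0))"

definition shiftT :: "int \<Rightarrow> bas list \<Rightarrow> vec" where
  "shiftT k L = delta (map (\<lambda>(a, j). (a + k, j)) L)"

definition zsumT :: "bas list \<Rightarrow> vec" where
  "zsumT L = (\<lambda>M. \<Sum>r<length L. if M = L[r := (fst (L ! r) + 1, snd (L ! r))] then 1 else 0)"

inductive_set Nsp :: "vec set" where
  base: "delta [(0, 0), (0, 0)] \<in> Nsp"
| zero: "(\<lambda>M. 0) \<in> Nsp"
| add: "x \<in> Nsp \<Longrightarrow> y \<in> Nsp \<Longrightarrow> (\<lambda>M. x M + y M) \<in> Nsp"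
| smult: "x \<in> Nsp \<Longrightarrow> (\<lambda>M. c * x M) \<in> Nsp"
| e_op: "x \<in> Nsp \<Longrightarrow> i \<in> {0, 1} \<Longrightarrow> lin (eT i) x \<in> Nsp"
| f_op: "x \<in> Nsp \<Longrightarrow> i \<in> {0, 1} \<Longrightarrow> lin (fT i) x \<in> Nsp"
| qh_op: "x \<in> Nsp \<Longrightarrow> lin (qhT h) x \<in> Nsp"
| zz_op: "x \<in> Nsp \<Longrightarrow> lin (shiftT 1) x \<in> Nsp"
| zzinv_op: "x \<in> Nsp \<Longrightarrow> lin (shiftT (-1)) x \<in> Nsp"
| zsum_op: "x \<in> Nsp \<Longrightarrow> lin zsumT x \<in> Nsp"

definition embed :: "bas list \<Rightarrow> vec \<Rightarrow> bas list \<Rightarrow> vec" where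
  "embed xs w ys = (\<lambda>M. if length M = length xs + 2 + length ys \<and> take (length xs) M = xs
                          \<and> drop (length xs + 2) M = ys
                        then w (take 2 (drop (length xs) M)) else 0)"

text \<open>N_n = sum over r of V^{(x) r} (x) N (x) V^{(x)(n-r-2)} (spanned by basis (x) N (x) basis).\<close>
inductive_set NN :: "nat \<Rightarrow> vec set" for n :: nat where
  zero: "(\<lambda>M. 0) \<in> NN n"
| add: "x \<in> NN n \<Longrightarrow> y \<in> NN n \<Longrightarrow> (\<lambda>M. x M + y M) \<in> NN n"
| smult: "x \<in> NN n \<Longrightarrow> (\<lambda>M. c * x M) \<in> NN n"
| gen: "w \<in> Nsp \<Longrightarrow> valid xs \<Longrightarrow> valid ys \<Longrightarrow> length xs + 2 + length ys = n \<Longrightarrow> embed xs w ys \<in> NN n"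

definition Henergy :: "bas \<Rightarrow> bas \<Rightarrow> int" where
  "Henergy b b' = min (int (snd b)) (2 - int (snd b')) - fst b + fst b'"

definition normally_ordered :: "bas list \<Rightarrow> bool" where
  "normally_ordered L \<longleftrightarrow> (\<forall>r. Suc r < length L \<longrightarrow> Henergy (L ! r) (L ! Suc r) > 0)"

definition NO :: "nat \<Rightarrow> bas list set" where
  "NO n = {L. length L = n \<and> valid L \<and> normally_ordered L}"

end

theory Submission
  imports Defs
begin

text \<open>As a module over the symmetric Laurent polynomials in \<open>x = z \<otimes> 1\<close> and \<open>y = 1 \<otimes> z\<close>, the space
  \<open>N\<close> is generated by nine vectors \<open>C\<^sub>i\<^sub>j\<close>. For the lexicographic order in which \<open>z\<^sup>a v\<^sub>j\<close> has rank
  \<open>3 a - j\<close>, the leading term of \<open>C\<^sub>i\<^sub>j\<close> is \<open>x\<^sup>h v\<^sub>i \<otimes> v\<^sub>j\<close> with \<open>h = min i (2 - j)\<close>, a pair of energy 0;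
  the products of \<open>C\<^sub>i\<^sub>j\<close> with powers of \<open>x + y\<close> and \<open>x y\<close> then have as leading terms all pairs of energy
  at most 0. Hence the normally ordered words are the irreducible words of a quadratic rewriting
  system, and the theorem is an instance of the diamond lemma. Its overlaps are resolved by
  elements of \<open>(N \<otimes> V) \<inter> (V \<otimes> N)\<close> with prescribed leading term: 27 explicit ones, multiplied by the
  elementary symmetric polynomials in three variables.

  A vector is represented by a list of pairs (coefficient, basis element), and two lists
  represent the same vector if \<open>val \<psi>\<close> agrees on them for every functional \<open>\<psi>\<close>, given by its values on
  the basis.\<close>

section \<open>The diamond lemma for quadratic relations\<close>

definition val :: "('b \<Rightarrow> 'k::comm_ring_1) \<Rightarrow> ('k \<times> 'b) list \<Rightarrow> 'k" where
  "val \<psi> \<alpha> = (\<Sum>(k, b)\<leftarrow>\<alpha>. k * \<psi> b)"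

lemma val_Nil [simp]: "val \<psi> [] = 0"
  and val_Cons [simp]: "val \<psi> ((k, b) # \<alpha>) = k * \<psi> b + val \<psi> \<alpha>"
  and val_append [simp]: "val \<psi> (\<alpha> @ \<beta>) = val \<psi> \<alpha> + val \<psi> \<beta>"
  by (simp_all add: val_def)

lemma val_cong: "(\<And>k b. (k, b) \<in> set \<alpha> \<Longrightarrow> \<psi> b = \<psi>' b) \<Longrightarrow> val \<psi> \<alpha> = val \<psi>' \<alpha>"
  unfolding val_def by (intro arg_cong[where f = sum_list] map_cong) auto

lemma val_zero [simp]: "val (\<lambda>b. 0) \<alpha> = 0"
  by (induction \<alpha>) auto

lemma val_eq_0: "(\<And>k b. (k, b) \<in> set \<alpha> \<Longrightarrow> \<psi> b = 0) \<Longrightarrow> val \<psi> \<alpha> = 0"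
  using val_cong[of \<alpha> \<psi> "\<lambda>b. 0"] by simp

lemma val_add: "val (\<lambda>b. \<psi> b + \<psi>' b) \<alpha> = val \<psi> \<alpha> + val \<psi>' \<alpha>"
  by (induction \<alpha>) (auto simp: algebra_simps)

lemma val_mult: "val (\<lambda>b. c * \<psi> b) \<alpha> = c * val \<psi> \<alpha>"
  by (induction \<alpha>) (auto simp: algebra_simps)

text \<open>Fubini for a bilinear evaluation; \<open>kills_disjoint\<close> uses it to apply two
  relations at disjoint places in either order.\<close>

lemma val_swap: "val (\<lambda>x. val (F x) \<beta>) \<alpha> = val (\<lambda>y. val (\<lambda>x. F x y) \<alpha>) \<beta>"
  by (induction \<alpha>) (auto simp: val_add val_mult)

lemma val_sum: "finite S \<Longrightarrow> val (\<lambda>b. \<Sum>s\<in>S. F s b) \<alpha> = (\<Sum>s\<in>S. val (F s) \<alpha>)"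
  by (induction S rule: finite_induct) (auto simp: val_add)

text \<open>Each relation is monic with its leading pair at the head of the list. The assumption
  \<open>confluent\<close> is a syzygy: the two relations at an overlap, each corrected by relations
  with smaller leading words, give the same tensor. Equality of tensors is tested on all functionals
  \<psi>, so lists need no normal form.\<close>

locale quadratic_rewriting =
  fixes R :: "('a list \<times> 'a list) set"
    and bad :: "'a \<Rightarrow> 'a \<Rightarrow> bool"
    and rel :: "'a \<Rightarrow> 'a \<Rightarrow> ('k::comm_ring_1 \<times> 'a \<times> 'a) list"
  assumes wf_R: "wf R"
    and in_context: "(M, L) \<in> R \<Longrightarrow> (u @ M @ v, u @ L @ v) \<in> R"
    and rel_lead: "bad c d \<Longrightarrow> \<exists>r. rel c d = (1, c, d) # r \<and>
          (\<forall>(k, c', d') \<in> set r. ([c', d'], [c, d]) \<in> R)"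
    and confluent: "bad a b \<Longrightarrow> bad b c \<Longrightarrow> \<exists>\<alpha> \<beta>.
          (\<forall>(k, a', b', c') \<in> set \<alpha>. bad a' b' \<and> ([a', b', c'], [a, b, c]) \<in> R) \<and>
          (\<forall>(k, a', b', c') \<in> set \<beta>. bad b' c' \<and> ([a', b', c'], [a, b, c]) \<in> R) \<and>
          (\<forall>\<psi>. val (\<lambda>(a, b, c). val (\<lambda>(x, y). \<psi> (x, y, c)) (rel a b)) ((1, a, b, c) # \<alpha>)
             = val (\<lambda>(a, b, c). val (\<lambda>(x, y). \<psi> (a, x, y)) (rel b c)) ((1, a, b, c) # \<beta>))"
begin

definition reducible :: "'a list \<Rightarrow> bool" where
  "reducible w \<longleftrightarrow> (\<exists>u c d v. w = u @ c # d # v \<and> bad c d)"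

text \<open>An arbitrary choice when there are several bad pairs; \<open>kills_ext\<close> shows
  that it does not matter.\<close>

definition redex :: "'a list \<Rightarrow> 'a list \<times> 'a \<times> 'a \<times> 'a list" where
  "redex w = (SOME (u, c, d, v). w = u @ c # d # v \<and> bad c d)"

text \<open>At a reducible word the value is forced by the relation at the one chosen redex: solve
  it for its leading term, whose coefficient is 1. Hence \<open>tl\<close> and the minus
  sign.\<close>

definition step :: "('a list \<Rightarrow> 'k) \<Rightarrow> ('a list \<Rightarrow> 'k) \<Rightarrow> 'a list \<Rightarrow> 'k" where
  "step \<phi>\<^sub>0 f w = (if reducible w
     then case redex w of (u, c, d, v) \<Rightarrow> - val (\<lambda>(x, y). f (u @ x # y # v)) (tl (rel c d))
     else \<phi>\<^sub>0 w)"

definition ext :: "('a list \<Rightarrow> 'k) \<Rightarrow> 'a list \<Rightarrow> 'k" where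
  "ext \<phi>\<^sub>0 = wfrec R (step \<phi>\<^sub>0)"

lemma ext_unfold: "ext \<phi>\<^sub>0 w = step \<phi>\<^sub>0 (cut (ext \<phi>\<^sub>0) R w) w"
  unfolding ext_def by (rule wfrec[OF wf_R])

definition kills :: "('a list \<Rightarrow> 'k) \<Rightarrow> 'a list \<Rightarrow> 'a \<Rightarrow> 'a \<Rightarrow> 'a list \<Rightarrow> 'k" where
  "kills \<phi> u c d v = val (\<lambda>(x, y). \<phi> (u @ x # y # v)) (rel c d)"

lemma context2: "([c', d'], [c, d]) \<in> R \<Longrightarrow> (u @ c' # d' # v, u @ c # d # v) \<in> R"
  using in_context[of "[c', d']" "[c, d]" u v] by simp

lemma context3: "([a', b', c'], [a, b, c]) \<in> R \<Longrightarrow> (u @ a' # b' # c' # v, u @ a # b # c # v) \<in> R"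
  using in_context[of "[a', b', c']" "[a, b, c]" u v] by simp

lemma ext_irreducible: "\<not> reducible w \<Longrightarrow> ext \<phi>\<^sub>0 w = \<phi>\<^sub>0 w"
  by (simp add: ext_unfold[of _ w] step_def)

lemma redex: "reducible w \<Longrightarrow> redex w = (u, c, d, v) \<Longrightarrow> w = u @ c # d # v \<and> bad c d"
  using someI_ex[of "\<lambda>(u, c, d, v). w = u @ c # d # v \<and> bad c d"]
  unfolding reducible_def redex_def by auto

text \<open>All other words of the relation lie below \<open>w\<close> by \<open>context2\<close>,
  so the \<open>cut\<close> in the recursion leaves their values intact and the recursion equation
  is the relation itself.\<close>

lemma ext_redex:
  assumes "reducible w" "redex w = (u, c, d, v)"
  shows "kills (ext \<phi>\<^sub>0) u c d v = 0"
proof -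
  have w: "w = u @ c # d # v" "bad c d" using redex[OF assms] by auto
  obtain r where r: "rel c d = (1, c, d) # r" "\<forall>(k, c', d') \<in> set r. ([c', d'], [c, d]) \<in> R"
    using rel_lead[OF w(2)] by blast
  have "val (\<lambda>(x, y). cut (ext \<phi>\<^sub>0) R w (u @ x # y # v)) r = val (\<lambda>(x, y). ext \<phi>\<^sub>0 (u @ x # y # v)) r"
  proof (rule val_cong)
    fix k p assume p: "(k, p) \<in> set r"
    obtain x y where xy: "p = (x, y)" by force
    have "([x, y], [c, d]) \<in> R" using r(2) p xy by auto
    from context2[OF this, of u v]
    show "(case p of (x, y) \<Rightarrow> cut (ext \<phi>\<^sub>0) R w (u @ x # y # v)) = (case p of (x, y) \<Rightarrow> ext \<phi>\<^sub>0 (u @ x # y # v))"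
      by (simp add: xy cut_def w(1))
  qed
  then have "ext \<phi>\<^sub>0 w = - val (\<lambda>(x, y). ext \<phi>\<^sub>0 (u @ x # y # v)) r"
    using assms r(1) by (simp add: ext_unfold[of _ w] step_def)
  then show ?thesis by (simp add: kills_def r w)
qed

text \<open>Expand both redexes at once: since everything below \<open>w\<close> is already killed, the double
  sum equals either of the single ones.\<close>

lemma kills_disjoint:
  assumes "bad a b" "bad c d"
    and IH: "\<And>u' c' d' v'. (u' @ c' # d' # v', u\<^sub>0 @ a # b # m @ c # d # v\<^sub>0) \<in> R \<Longrightarrow>
               bad c' d' \<Longrightarrow> kills \<phi> u' c' d' v' = 0"
  shows "kills \<phi> u\<^sub>0 a b (m @ c # d # v\<^sub>0) = kills \<phi> (u\<^sub>0 @ a # b # m) c d v\<^sub>0"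
proof -
  obtain r where r: "rel a b = (1, a, b) # r" "\<forall>(k, c', d') \<in> set r. ([c', d'], [a, b]) \<in> R"
    using rel_lead[OF assms(1)] by blast
  obtain s where s: "rel c d = (1, c, d) # s" "\<forall>(k, c', d') \<in> set s. ([c', d'], [c, d]) \<in> R"
    using rel_lead[OF assms(2)] by blast
  define F where "F = (\<lambda>(x, y) (x', y'). \<phi> (u\<^sub>0 @ x # y # m @ x' # y' # v\<^sub>0))"
  have "val (F p) (rel c d) = 0" if p: "(k, p) \<in> set r" for k p
  proof -
    obtain x y where xy: "p = (x, y)" by force
    have "([x, y], [a, b]) \<in> R" using r(2) p xy by auto
    from context2[OF this, of u\<^sub>0 "m @ c # d # v\<^sub>0"]
    have "kills \<phi> (u\<^sub>0 @ x # y # m) c d v\<^sub>0 = 0"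
      by (intro IH assms(2)) simp
    then show ?thesis by (simp add: kills_def F_def xy case_prod_unfold)
  qed
  then have 1: "val (\<lambda>p. val (F p) (rel c d)) (rel a b) = val (F (a, b)) (rel c d)"
    by (simp add: r(1) val_eq_0)
  have "val (\<lambda>p. F p p') (rel a b) = 0" if p: "(k, p') \<in> set s" for k p'
  proof -
    obtain x y where xy: "p' = (x, y)" by force
    have "([x, y], [c, d]) \<in> R" using s(2) p xy by auto
    from context2[OF this, of "u\<^sub>0 @ a # b # m" v\<^sub>0]
    have "kills \<phi> u\<^sub>0 a b (m @ x # y # v\<^sub>0) = 0"
      by (intro IH assms(1)) simp
    then show ?thesis by (simp add: kills_def F_def xy case_prod_unfold)
  qed
  then have 2: "val (\<lambda>p'. val (\<lambda>p. F p p') (rel a b)) (rel c d) = val (\<lambda>p. F p (c, d)) (rel a b)"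
    by (simp add: s(1) val_eq_0)
  show ?thesis using 1 2 val_swap[of F "rel c d" "rel a b"]
    by (simp add: kills_def F_def case_prod_unfold)
qed

text \<open>Evaluate the syzygy on \<phi> in the surrounding context. Its correction terms are
  relations with smaller leading words, killed by the induction hypothesis, so only the two
  relations at the overlap survive.\<close>

lemma kills_overlap:
  assumes "bad a b" "bad b c"
    and IH: "\<And>u c' d v. (u @ c' # d # v, u\<^sub>0 @ a # b # c # v\<^sub>0) \<in> R \<Longrightarrow> bad c' d \<Longrightarrow>
               kills \<phi> u c' d v = 0"
  shows "kills \<phi> u\<^sub>0 a b (c # v\<^sub>0) = kills \<phi> (u\<^sub>0 @ [a]) b c v\<^sub>0"
proof -
  obtain \<alpha> \<beta> where
    \<alpha>: "\<forall>(k, a', b', c') \<in> set \<alpha>. bad a' b' \<and> ([a', b', c'], [a, b, c]) \<in> R" and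
    \<beta>: "\<forall>(k, a', b', c') \<in> set \<beta>. bad b' c' \<and> ([a', b', c'], [a, b, c]) \<in> R" and
    eq: "\<And>\<psi>. val (\<lambda>(a, b, c). val (\<lambda>(x, y). \<psi> (x, y, c)) (rel a b)) ((1, a, b, c) # \<alpha>)
             = val (\<lambda>(a, b, c). val (\<lambda>(x, y). \<psi> (a, x, y)) (rel b c)) ((1, a, b, c) # \<beta>)"
    using confluent[OF assms(1,2)] by (elim exE conjE) (erule that, assumption, erule spec)
  have "val (\<lambda>(a, b, c). kills \<phi> u\<^sub>0 a b (c # v\<^sub>0)) \<alpha> = 0"
    using \<alpha> by (intro val_eq_0) (auto intro!: IH dest!: bspec intro: context3)
  moreover have "val (\<lambda>(a, b, c). kills \<phi> (u\<^sub>0 @ [a]) b c v\<^sub>0) \<beta> = 0"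
    using \<beta> by (intro val_eq_0) (auto intro!: IH dest!: bspec intro: context3)
  ultimately show ?thesis
    using eq[of "\<lambda>(x, y, z). \<phi> (u\<^sub>0 @ x # y # z # v\<^sub>0)"] by (simp add: kills_def)
qed

text \<open>Well-founded induction on the leading word \<open>w\<close>: all redexes of
  \<open>w\<close> give the same value, and the chosen one gives 0 by
  \<open>ext_redex\<close>.\<close>

lemma kills_ext:
  "w = u @ c # d # v \<Longrightarrow> bad c d \<Longrightarrow> kills (ext \<phi>\<^sub>0) u c d v = 0"
proof (induction w arbitrary: u c d v rule: wf_induct_rule[OF wf_R])
  case (1 w)
  have less: "kills (ext \<phi>\<^sub>0) u c d v = 0" if "(u @ c # d # v, w) \<in> R" "bad c d" for u c d v
    using 1(1)[OF that(1) refl that(2)] .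
  have wlog: "kills (ext \<phi>\<^sub>0) u c d v = kills (ext \<phi>\<^sub>0) u' c' d' v'"
    if w: "w = u @ c # d # v" "w = u' @ c' # d' # v'" "bad c d" "bad c' d'" "length u \<le> length u'"
    for u c d v u' c' d' v'
  proof -
    obtain m where m: "u' = u @ m" "c # d # v = m @ c' # d' # v'"
      using w(1,2,5) by (metis append_eq_append_conv_if append_take_drop_id)
    \<comment> \<open>\<open>m\<close> lies between the starts of the two redexes: they coincide,
      share one letter, or are disjoint.\<close>
    consider "m = []" | "m = [c]" | m' where "m = c # d # m'"
      using m(2) by (cases m; cases "tl m") auto
    then show ?thesis
    proof cases
      case 1
      then show ?thesis using m by simp
    next
      case 2
      then have "c' = d" "v = d' # v'" using m by auto
      then show ?thesis
        using kills_overlap[of c d d' u v' "ext \<phi>\<^sub>0"] less w m(1) 2 by simp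
    next
      case 3
      then have "v = m' @ c' # d' # v'" using m by auto
      then show ?thesis
        using kills_disjoint[of c d c' d' u m' v' "ext \<phi>\<^sub>0"] less w m(1) 3 by simp
    qed
  qed
  have red: "reducible w" using 1(2,3) unfolding reducible_def by blast
  obtain u' c' d' v' where r: "redex w = (u', c', d', v')" by (metis prod_cases4)
  have "kills (ext \<phi>\<^sub>0) u c d v = kills (ext \<phi>\<^sub>0) u' c' d' v'"
  proof (cases "length u \<le> length u'")
    case True
    show ?thesis using redex[OF red r] 1(2,3) True by (intro wlog) auto
  next
    case False
    show ?thesis using redex[OF red r] 1(2,3) False by (intro wlog[symmetric]) auto
  qed
  then show ?case using ext_redex[OF red r] by simp
qed

text \<open>The dual form of linear independence: arbitrary values on the irreducible words extend
  to a functional on the quotient by the relations.\<close>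

theorem diamond:
  "\<exists>\<phi>. (\<forall>w. \<not> reducible w \<longrightarrow> \<phi> w = \<phi>\<^sub>0 w) \<and>
       (\<forall>u c d v. bad c d \<longrightarrow> val (\<lambda>(x, y). \<phi> (u @ x # y # v)) (rel c d) = 0)"
  using ext_irreducible kills_ext unfolding kills_def by blast

end

section \<open>Order on words and rewriting rules\<close>

definition zshift :: "int \<Rightarrow> bas \<Rightarrow> bas" where
  "zshift k c = (fst c + k, snd c)"

definition rho :: "bas \<Rightarrow> int" where
  "rho c = 3 * fst c - int (snd c)"

lemma zshift_simps [simp]: "fst (zshift k c) = fst c + k" "snd (zshift k c) = snd c" "zshift k (a, j) = (a + k, j)"
  "rho (zshift k c) = rho c + 3 * k" "zshift k (zshift l c) = zshift (l + k) c" "zshift 0 c = c"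
  by (auto simp: zshift_def rho_def)

text \<open>The bounds on the exponents are what makes the lexicographic order well-founded.\<close>

definition word_less :: "(bas list \<times> bas list) set" where
  "word_less = {(M, L). length M = length L \<and> sum_list (map snd M) = sum_list (map snd L) \<and>
     (\<forall>c\<in>set M. (\<exists>d\<in>set L. fst d \<le> fst c) \<and> (\<exists>d\<in>set L. fst c \<le> fst d)) \<and>
     (map rho M, map rho L) \<in> lex {(x, y). x < y}}"

lemma word_less_range:
  assumes "(M, L) \<in> word_less" "c \<in> set M"
  obtains d d' where "d \<in> set L" "d' \<in> set L" "fst d \<le> fst c" "fst c \<le> fst d'"
  using assms by (auto simp: word_less_def)

text \<open>The order is irreflexive and transitive, and every word has only finitely many
  predecessors.\<close>

lemma wf_word_less: "wf word_less"
proof (rule wf_finite_segments)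
  have asym: "asym (lex {(x::int, y). x < y})"
    by (rule asym_lex) (auto intro!: asymI)
  show "irrefl word_less"
    using asym by (auto simp: irrefl_def word_less_def dest: asymD)
  have tr: "trans (lex {(x::int, y). x < y})"
    by (rule lex_transI) (auto intro!: transI)
  show "trans word_less"
  proof (rule transI)
    fix x y z assume xy: "(x, y) \<in> word_less" and yz: "(y, z) \<in> word_less"
    have "(\<exists>d\<in>set z. fst d \<le> fst c) \<and> (\<exists>d\<in>set z. fst c \<le> fst d)" if c: "c \<in> set x" for c
    proof -
      obtain d d' where d: "d \<in> set y" "d' \<in> set y" "fst d \<le> fst c" "fst c \<le> fst d'"
        using word_less_range[OF xy c] .
      obtain e where "e \<in> set z" "fst e \<le> fst d"
        using word_less_range[OF yz d(1)] .
      moreover obtain e' where "e' \<in> set z" "fst d' \<le> fst e'"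
        using word_less_range[OF yz d(2)] .
      ultimately show ?thesis using d(3,4) by (meson order_trans)
    qed
    moreover have "(map rho x, map rho z) \<in> lex {(x, y). x < y}"
      using xy yz transD[OF tr, of "map rho x" "map rho y" "map rho z"] by (simp add: word_less_def)
    ultimately show "(x, z) \<in> word_less"
      using xy yz by (simp add: word_less_def)
  qed
  fix L :: "bas list"
  \<comment> \<open>A finite alphabet for all words below \<open>L\<close>: exponents stay between
    the extreme exponents of \<open>L\<close>, and each index is at most the conserved sum of
    indices.\<close>
  let ?A = "{Min (fst ` set L)..Max (fst ` set L)} \<times> {..sum_list (map snd L)}"
  have "{M :: bas list. (M, L) \<in> word_less} \<subseteq> {M. set M \<subseteq> ?A \<and> length M = length L}"
  proof clarify
    fix M :: "bas list" assume M: "(M, L) \<in> word_less"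
    have "fst c \<in> {Min (fst ` set L)..Max (fst ` set L)}" if c: "c \<in> set M" for c
    proof -
      obtain d d' where "d \<in> set L" "d' \<in> set L" "fst d \<le> fst c" "fst c \<le> fst d'"
        using word_less_range[OF M c] .
      moreover have "Min (fst ` set L) \<le> fst d" "fst d' \<le> Max (fst ` set L)"
        using \<open>d \<in> set L\<close> \<open>d' \<in> set L\<close> by simp_all
      ultimately show ?thesis by (metis atLeastAtMost_iff order_trans)
    qed
    moreover have "snd c \<le> sum_list (map snd L)" if "c \<in> set M" for c
      using M that member_le_sum_list[of "snd c" "map snd M"] unfolding word_less_def by auto
    ultimately have "set M \<subseteq> ?A" by (auto simp: mem_Times_iff)
    then show "set M \<subseteq> ?A \<and> length M = length L" using M unfolding word_less_def by auto
  qed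
  moreover have "finite {M :: bas list. set M \<subseteq> ?A \<and> length M = length L}"
    by (rule finite_lists_length_eq) auto
  ultimately show "finite {M :: bas list. (M, L) \<in> word_less}" by (rule finite_subset)
qed

lemma word_less_context: "(M, L) \<in> word_less \<Longrightarrow> (u @ M @ v, u @ L @ v) \<in> word_less"
  unfolding word_less_def
  by (auto intro!: lex_append_leftI lex_append_rightI)

text \<open>Multiplication by x + y, just as \<open>shift2 b\<close> is multiplication by the b-th
  power of x y. The term shifted in its first factor is listed first, so the leading term stays at
  the head.\<close>

definition esum :: "('k \<times> bas \<times> bas) list \<Rightarrow> ('k \<times> bas \<times> bas) list" where
  "esum \<alpha> = concat (map (\<lambda>(k, c, d). [(k, zshift 1 c, d), (k, c, zshift 1 d)]) \<alpha>)"

definition shift2 :: "int \<Rightarrow> ('k \<times> bas \<times> bas) list \<Rightarrow> ('k \<times> bas \<times> bas) list" where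
  "shift2 b = map (\<lambda>(k, c, d). (k, zshift b c, zshift b d))"

lemma esum_simps [simp]: "esum [] = []"
  "esum ((k, c, d) # \<alpha>) = (k, zshift 1 c, d) # (k, c, zshift 1 d) # esum \<alpha>"
  by (auto simp: esum_def)

lemma shift2_simps [simp]: "shift2 b [] = []"
  "shift2 b ((k, c, d) # \<alpha>) = (k, zshift b c, zshift b d) # shift2 b \<alpha>"
  by (auto simp: shift2_def)

lemma shift2_0 [simp]: "shift2 0 \<alpha> = \<alpha>"
  by (induction \<alpha>) auto

lemma shift2_shift2: "shift2 a (shift2 b \<alpha>) = shift2 (b + a) \<alpha>"
  by (induction \<alpha>) auto

lemma shift2_esum: "shift2 b (esum \<alpha>) = esum (shift2 b \<alpha>)"
  by (induction \<alpha>) (auto simp: add_ac)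

lemma esum_mem: "(k, e) \<in> set (esum \<alpha>) \<Longrightarrow>
    \<exists>c d. (k, c, d) \<in> set \<alpha> \<and> (e = (zshift 1 c, d) \<or> e = (c, zshift 1 d))"
proof (induction \<alpha>)
  case (Cons p \<alpha>)
  obtain k' c d where "p = (k', c, d)" by (rule prod_cases3)
  then show ?case using Cons by (simp del: split_paired_Ex) blast
qed simp

lemma shift2_mem: "(k, e) \<in> set (shift2 b \<alpha>) \<Longrightarrow> \<exists>c d. (k, c, d) \<in> set \<alpha> \<and> e = (zshift b c, zshift b d)"
proof (induction \<alpha>)
  case (Cons p \<alpha>)
  obtain k' c d where "p = (k', c, d)" by (rule prod_cases3)
  then show ?case using Cons by (simp del: split_paired_Ex) blast
qed simp

lemma val_esum: "val \<psi> (esum \<alpha>) = val (\<lambda>(c, d). \<psi> (zshift 1 c, d) + \<psi> (c, zshift 1 d)) \<alpha>"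
  by (induction \<alpha>) (auto simp: algebra_simps)

lemma val_shift2: "val \<psi> (shift2 b \<alpha>) = val (\<lambda>(c, d). \<psi> (zshift b c, zshift b d)) \<alpha>"
  by (induction \<alpha>) auto

section \<open>Pairs of energy at most 0 and their relations\<close>

definition bad :: "bas \<Rightarrow> bas \<Rightarrow> bool" where
  "bad c d \<longleftrightarrow> snd c \<le> 2 \<and> snd d \<le> 2 \<and> Henergy c d \<le> 0"

text \<open>\<open>Crel i j\<close> is the generator \<open>C\<^sub>i\<^sub>j\<close>, with its leading term in front; \<open>grel c d\<close> is the element
  \<open>(x y)\<^sup>b (x + y)\<^sup>k C\<^sub>i\<^sub>j\<close> of \<open>N\<close> with leading term \<open>c \<otimes> d\<close>.\<close>

definition Crel :: "nat \<Rightarrow> nat \<Rightarrow> (K \<times> bas \<times> bas) list" where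
  "Crel i j =
    (if i = 0 \<and> j = 0 then [(1, (0, 0), (0, 0))]
     else if i = 0 \<and> j = 1 then [(1, (0, 0), (0, 1)), (qq^2, (0, 1), (0, 0))]
     else if i = 1 \<and> j = 0 then [(1, (1, 1), (0, 0)), (qq^2, (0, 0), (1, 1))]
     else if i = 0 \<and> j = 2 then [(1, (0, 0), (0, 2)), (qq, (0, 1), (0, 1)), (qq^4, (0, 2), (0, 0))]
     else if i = 1 \<and> j = 1 then [(1, (1, 1), (0, 1)), (qq^2, (0, 1), (1, 1)),
       (qq + qq^3, (0, 0), (1, 2)), (qq + qq^3, (1, 2), (0, 0))]
     else if i = 2 \<and> j = 0 then [(1, (2, 2), (0, 0)), (qq, (1, 1), (1, 1)), (qq^4, (0, 0), (2, 2))]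
     else if i = 1 \<and> j = 2 then [(1, (0, 1), (0, 2)), (qq^2, (0, 2), (0, 1))]
     else if i = 2 \<and> j = 1 then [(1, (1, 2), (0, 1)), (qq^2, (0, 1), (1, 2))]
     else [(1, (0, 2), (0, 2))])"

definition grel :: "bas \<Rightarrow> bas \<Rightarrow> (K \<times> bas \<times> bas) list" where
  "grel c d = shift2 (fst d) ((esum ^^ nat (- Henergy c d)) (Crel (snd c) (snd d)))"

lemma Henergy_zshift: "Henergy (zshift a c) d = Henergy c d - a" "Henergy c (zshift a d) = Henergy c d + a"
  by (auto simp: Henergy_def)

lemma bad_zshift [simp]: "bad c d \<Longrightarrow> 0 \<le> a \<Longrightarrow> bad (zshift a c) d" "bad (zshift a c) (zshift a d) = bad c d"
  by (auto simp: bad_def Henergy_zshift)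

lemma bad_ge: "bad c d \<Longrightarrow> fst d \<le> fst c"
  by (auto simp: bad_def Henergy_def)

lemma grel_base: "i \<le> 2 \<Longrightarrow> j \<le> 2 \<Longrightarrow> grel (min (int i) (2 - int j), i) (0, j) = Crel i j"
  by (simp add: grel_def Henergy_def)

lemma grel_esum:
  assumes "bad c d"
  shows "grel (zshift 1 c) d = esum (grel c d)"
proof -
  have "nat (- Henergy (zshift 1 c) d) = Suc (nat (- Henergy c d))"
    using assms unfolding bad_def Henergy_zshift by arith
  then show ?thesis by (simp add: grel_def shift2_esum)
qed

lemma grel_shift: "grel (zshift b c) (zshift b d) = shift2 b (grel c d)"
  by (simp add: grel_def Henergy_zshift shift2_shift2)

text \<open>The nine base pairs have energy 0. Raising the exponent of the first letter lowers the
  energy by 1 and a common shift preserves it, so all bad pairs are reached. The three cases match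
  the roles of \<open>Crel\<close>, \<open>esum\<close> and \<open>shift2\<close> in
  \<open>grel\<close>.\<close>

lemma bad_induct [consumes 1, case_names base sum shift]:
  assumes "bad c d"
    and base: "\<And>i j. i \<le> 2 \<Longrightarrow> j \<le> 2 \<Longrightarrow> P (min (int i) (2 - int j), i) (0, j)"
    and sum: "\<And>c d. bad c d \<Longrightarrow> P c d \<Longrightarrow> P (zshift 1 c) d"
    and shift: "\<And>b c d. bad c d \<Longrightarrow> P c d \<Longrightarrow> P (zshift b c) (zshift b d)"
  shows "P c d"
proof -
  define i j where ij: "i = snd c" "j = snd d"
  define h where "h = min (int i) (2 - int j)"
  have bd: "bad (h + int m, i) (0, j)" for m
    using assms(1) by (auto simp: ij h_def bad_def Henergy_def)
  have P: "P (h + int m, i) (0, j)" for m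
  proof (induction m)
    case 0
    show ?case using base[of i j] assms(1) by (auto simp: ij h_def bad_def)
  next
    case (Suc m)
    show ?case using sum[OF bd Suc] by (simp add: add_ac)
  qed
  have "P (zshift (fst d) (h + int (nat (- Henergy c d)), i)) (zshift (fst d) (0, j))"
    by (intro shift bd P)
  also have "zshift (fst d) (h + int (nat (- Henergy c d)), i) = c"
    using assms(1) by (auto simp: bad_def h_def ij Henergy_def zshift_def prod_eq_iff)
  also have "zshift (fst d) (0, j) = d" by (simp add: ij)
  finally show ?thesis .
qed

text \<open>In the 27 base triples both neighbouring pairs have energy 0. Case \<open>sum1\<close>
  lowers the energy of the first pair only, \<open>sum2\<close> that of the second only. The three
  shifts are multiplications by z1, by z1 z2 and by powers of z1 z2 z3, the leading monomials of the
  elementary symmetric polynomials.\<close>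

lemma bad2_induct [consumes 2, case_names base sum1 sum2 shift]:
  assumes "bad a b" "bad b c"
    and base: "\<And>i j k. i \<le> 2 \<Longrightarrow> j \<le> 2 \<Longrightarrow> k \<le> 2 \<Longrightarrow>
      P (min (int i) (2 - int j) + min (int j) (2 - int k), i) (min (int j) (2 - int k), j) (0, k)"
    and sum1: "\<And>a b c. bad a b \<Longrightarrow> bad b c \<Longrightarrow> P a b c \<Longrightarrow> P (zshift 1 a) b c"
    and sum2: "\<And>a b c. bad a b \<Longrightarrow> bad b c \<Longrightarrow> P a b c \<Longrightarrow> P (zshift 1 a) (zshift 1 b) c"
    and shift: "\<And>m a b c. bad a b \<Longrightarrow> bad b c \<Longrightarrow> P a b c \<Longrightarrow> P (zshift m a) (zshift m b) (zshift m c)"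
  shows "P a b c"
proof -
  define i j k where ijk: "i = snd a" "j = snd b" "k = snd c"
  define h h' where "h = min (int i) (2 - int j)" and "h' = min (int j) (2 - int k)"
  note defs = ijk h_def h'_def bad_def Henergy_def
  have bd: "bad (h + int m + (h' + int n), i) (h' + int n, j)" "bad (h' + int n, j) (0, k)" for m n
    using assms(1,2) by (auto simp: defs)
  have P0: "P (h + int m + h', i) (h', j) (0, k)" for m
  proof (induction m)
    case 0
    show ?case using base[of i j k] assms(1,2) by (auto simp: defs)
  next
    case (Suc m)
    show ?case using sum1[of "(h + int m + h', i)" "(h', j)" "(0, k)"] bd(1)[of m 0] bd(2)[of 0] Suc
      by (simp add: add_ac)
  qed
  have P: "P (h + int m + (h' + int n), i) (h' + int n, j) (0, k)" for m n
  proof (induction n)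
    case 0
    show ?case using P0[of m] by simp
  next
    case (Suc n)
    show ?case using sum2[OF bd Suc] by (simp add: add_ac)
  qed
  define m n where mn: "m = nat (- Henergy a b)" "n = nat (- Henergy b c)"
  have "P (zshift (fst c) (h + int m + (h' + int n), i)) (zshift (fst c) (h' + int n, j)) (zshift (fst c) (0, k))"
    by (intro shift bd P)
  also have "zshift (fst c) (h + int m + (h' + int n), i) = a"
    using assms(1,2) by (auto simp: defs mn zshift_def prod_eq_iff)
  also have "zshift (fst c) (h' + int n, j) = b"
    using assms(1,2) by (auto simp: defs mn zshift_def prod_eq_iff)
  also have "zshift (fst c) (0, k) = c" by (simp add: ijk)
  finally show ?thesis .
qed

text \<open>The properties of the non-leading terms that survive the induction along
  \<open>bad_induct\<close>. The comparison is decided at the first letter; the two conserved sums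
  also make \<open>grel c d\<close> a weight vector, as \<open>annihilates_qh\<close>
  requires.\<close>

definition lower :: "bas \<Rightarrow> bas \<Rightarrow> bas \<Rightarrow> bas \<Rightarrow> bool" where
  "lower c d c' d' \<longleftrightarrow> fst c' + fst d' = fst c + fst d \<and> snd c' + snd d' = snd c + snd d \<and>
     snd c' \<le> 2 \<and> snd d' \<le> 2 \<and> fst d \<le> fst c' \<and> fst c' \<le> fst c \<and> rho c' < rho c"

text \<open>Multiplication by x + y sends the leading term to \<open>(zshift 1 c, d)\<close> and
  \<open>(c, zshift 1 d)\<close>. The second is lower, its exponents staying in range because
  \<open>fst d \<le> fst c\<close> by \<open>bad_ge\<close>.\<close>

lemma grel_lead:
  "bad c d \<Longrightarrow> \<exists>r. grel c d = (1, c, d) # r \<and> (\<forall>(k, c', d') \<in> set r. lower c d c' d')"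
proof (induction rule: bad_induct)
  case (base i j)
  then have "i \<in> {0, 1, 2}" "j \<in> {0, 1, 2}" by auto
  then show ?case unfolding grel_base[OF base]
    by (auto simp: Crel_def lower_def rho_def)
next
  case (sum c d)
  then obtain r where r: "grel c d = (1, c, d) # r" "\<forall>(k, c', d') \<in> set r. lower c d c' d'"
    by blast
  have "lower (zshift 1 c) d c' d'" if m: "(k, c', d') \<in> set (esum r)" for k c' d'
  proof -
    obtain x y where xy: "(k, x, y) \<in> set r" "(c', d') = (zshift 1 x, y) \<or> (c', d') = (x, zshift 1 y)"
      using esum_mem[OF m] by blast
    have "lower c d x y" using r(2) xy(1) by blast
    then show ?thesis using xy(2) by (auto simp: lower_def)
  qed
  moreover have "lower (zshift 1 c) d c (zshift 1 d)"
    using bad_ge[OF sum(1)] sum(1) by (auto simp: lower_def bad_def)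
  ultimately show ?case using grel_esum[OF sum(1)] r(1) by auto
next
  case (shift b c d)
  then obtain r where r: "grel c d = (1, c, d) # r" "\<forall>(k, c', d') \<in> set r. lower c d c' d'"
    by blast
  have "lower (zshift b c) (zshift b d) c' d'" if m: "(k, c', d') \<in> set (shift2 b r)" for k c' d'
  proof -
    obtain x y where xy: "(k, x, y) \<in> set r" "(c', d') = (zshift b x, zshift b y)"
      using shift2_mem[OF m] by blast
    have "lower c d x y" using r(2) xy(1) by blast
    then show ?thesis using xy(2) by (auto simp: lower_def)
  qed
  then show ?case using grel_shift r(1) by auto
qed

lemma lower_word_less: "lower c d c' d' \<Longrightarrow> ([c', d'], [c, d]) \<in> word_less"
  by (auto simp: lower_def word_less_def)

section \<open>Confluence\<close>

type_synonym triple = "bas \<times> bas \<times> bas"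

text \<open>A triple \<open>(a, b, c)\<close> stands for \<open>grel a b \<otimes> c\<close> in \<open>left_val\<close> and for \<open>a \<otimes> grel b c\<close> in \<open>right_val\<close>.\<close>

definition left_val :: "(triple \<Rightarrow> K) \<Rightarrow> triple \<Rightarrow> K" where
  "left_val \<psi> = (\<lambda>(a, b, c). val (\<lambda>(x, y). \<psi> (x, y, c)) (grel a b))"

definition right_val :: "(triple \<Rightarrow> K) \<Rightarrow> triple \<Rightarrow> K" where
  "right_val \<psi> = (\<lambda>(a, b, c). val (\<lambda>(x, y). \<psi> (a, x, y)) (grel b c))"

definition left_bad :: "triple \<Rightarrow> bool" where "left_bad = (\<lambda>(a, b, c). bad a b)"
definition right_bad :: "triple \<Rightarrow> bool" where "right_bad = (\<lambda>(a, b, c). bad b c)"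

text \<open>A sufficient condition for \<open>word_less\<close> that is easy to transport along
  shifts. At an overlap the exponents decrease weakly from \<open>a\<close> to \<open>c\<close> by
  \<open>bad_ge\<close>, so the interval is the exponent range of the word.\<close>

definition triple_less :: "triple \<Rightarrow> triple \<Rightarrow> bool" where
  "triple_less = (\<lambda>(a', b', c') (a, b, c).
     {fst a', fst b', fst c'} \<subseteq> {fst c..fst a} \<and>
     snd a' + snd b' + snd c' = snd a + snd b + snd c \<and>
     (rho a' < rho a \<or> rho a' = rho a \<and> (rho b' < rho b \<or> rho b' = rho b \<and> rho c' < rho c)))"

text \<open>The common value of the two sides is an element of (N \<otimes> V) \<inter> (V \<otimes>
  N) with leading term \<open>t\<close>, expanded once in left and once in right relations.\<close>

definition joinable :: "triple \<Rightarrow> bool" where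
  "joinable t \<longleftrightarrow> (\<exists>\<alpha> \<beta>. (\<forall>(k, s) \<in> set \<alpha>. left_bad s \<and> triple_less s t) \<and>
     (\<forall>(k, s) \<in> set \<beta>. right_bad s \<and> triple_less s t) \<and>
     (\<forall>\<psi>. val (left_val \<psi>) ((1, t) # \<alpha>) = val (right_val \<psi>) ((1, t) # \<beta>)))"

lemma joinableI:
  assumes "\<forall>(k, s) \<in> set \<alpha>. left_bad s \<and> triple_less s t"
    and "\<forall>(k, s) \<in> set \<beta>. right_bad s \<and> triple_less s t"
    and "\<And>\<psi>. val (left_val \<psi>) ((1, t) # \<alpha>) = val (right_val \<psi>) ((1, t) # \<beta>)"
  shows "joinable t"
  using assms unfolding joinable_def by blast

lemma funpow_two: "(f ^^ 2) x = f (f x)"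
  by (simp add: numeral_2_eq_2)

lemmas syzygy = left_val_def right_val_def left_bad_def right_bad_def triple_less_def bad_def
  Henergy_def grel_def Crel_def funpow_two rho_def

text \<open>With the powers of \<open>qq\<close> expanded into products, each remaining goal is a
  polynomial identity in \<open>qq\<close> and values of \<psi>, settled by ring
  normalisation.\<close>

lemmas ring_normal = eval_nat_numeral algebra_simps

section \<open>The 27 overlaps in which both pairs have energy 0, named by their indices\<close>

text \<open>The two lists come from reducing the difference \<open>grel a b \<otimes> c - a \<otimes> grel b c\<close> to zero.\<close>

lemma joinable_000: "joinable ((0, 0), (0, 0), (0, 0))"
  by (rule joinableI[of
      "[]"
      _
      "[]"])
    (simp add: syzygy; simp add: ring_normal)+

lemma joinable_001: "joinable ((0, 0), (0, 0), (0, 1))"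
  by (rule joinableI[of
      "[(qq^2, (0, 0), (0, 1), (0, 0))]"
      _
      "[(qq^4, (0, 1), (0, 0), (0, 0))]"])
    (simp add: syzygy; simp add: ring_normal)+

lemma joinable_002: "joinable ((0, 0), (0, 0), (0, 2))"
  by (rule joinableI[of
      "[(qq, (0, 0), (0, 1), (0, 1)), (qq^4, (0, 0), (0, 2), (0, 0))]"
      _
      "[(qq^3, (0, 1), (0, 0), (0, 1)), (qq^8, (0, 2), (0, 0), (0, 0))]"])
    (simp add: syzygy; simp add: ring_normal)+

lemma joinable_010: "joinable ((1, 0), (1, 1), (0, 0))"
  by (rule joinableI[of
      "[(qq^2, (1, 0), (0, 0), (1, 1)), (qq^2, (1, 1), (0, 0), (1, 0))]"
      _
      "[(qq^2, (1, 1), (1, 0), (0, 0)), (qq^2, (0, 0), (1, 0), (1, 1))]"])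
    (simp add: syzygy; simp add: ring_normal)+

lemma joinable_011: "joinable ((1, 0), (1, 1), (0, 1))"
  by (rule joinableI[of
      "[(qq + qq^3, (1, 0), (1, 2), (0, 0)), (qq + qq^3, (1, 0), (0, 0), (1, 2)),
       (qq^2, (1, 0), (0, 1), (1, 1)), (qq^2, (1, 1), (0, 0), (1, 1)),
       (qq^4, (1, 1), (0, 1), (1, 0))]"
      _
      "[(qq^2, (1, 1), (1, 0), (0, 1)), (qq^2, (1, 1), (1, 1), (0, 0)),
       (qq^5 + qq^7, (1, 2), (1, 0), (0, 0)), (qq + qq^3, (0, 0), (1, 0), (1, 2)),
       (qq^4, (0, 1), (1, 0), (1, 1))]"])
    (simp add: syzygy; simp add: ring_normal)+

lemma joinable_012: "joinable ((0, 0), (0, 1), (0, 2))"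
  by (rule joinableI[of
      "[(qq^2, (0, 0), (0, 2), (0, 1)), (qq^6, (0, 1), (0, 2), (0, 0))]"
      _
      "[(qq^2, (0, 1), (0, 0), (0, 2)), (qq^6, (0, 2), (0, 0), (0, 1))]"])
    (simp add: syzygy; simp add: ring_normal)+

lemma joinable_020: "joinable ((2, 0), (2, 2), (0, 0))"
  by (rule joinableI[of
      "[(qq, (2, 0), (1, 1), (1, 1)), (qq^4, (2, 0), (0, 0), (2, 2)), (qq, (2, 1), (1, 1), (1, 0)),
       (qq^3, (2, 1), (0, 0), (2, 1)), (qq^4, (2, 2), (0, 0), (2, 0)),
       (qq^2 - qq^4, (1, 0), (1, 0), (2, 2)), (qq^3 - qq^5, (1, 0), (1, 1), (2, 1))]"
      _
      "[(qq, (2, 1), (2, 1), (0, 0)), (qq^4, (2, 2), (2, 0), (0, 0)),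
       (qq^2 - qq^4, (2, 2), (1, 0), (1, 0)), (qq, (1, 0), (2, 1), (1, 1)),
       (qq^3, (1, 1), (2, 0), (1, 1)), (qq^3 - qq^5, (1, 1), (2, 1), (1, 0)),
       (qq^4, (0, 0), (2, 0), (2, 2))]"])
    (simp add: syzygy; simp add: ring_normal)+

lemma joinable_021: "joinable ((1, 0), (1, 2), (0, 1))"
  by (rule joinableI[of
      "[(qq^2, (1, 0), (0, 1), (1, 2)), (qq^2 + qq^4, (1, 1), (1, 2), (0, 0)),
       (qq^2, (1, 1), (0, 0), (1, 2)), (qq^3, (1, 1), (0, 1), (1, 1)),
       (qq^6, (1, 2), (0, 1), (1, 0))]"
      _
      "[(qq, (1, 1), (1, 1), (0, 1)), (qq^4, (1, 2), (1, 0), (0, 1)),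
       (qq^4, (1, 2), (1, 1), (0, 0)), (qq^2 + qq^4, (0, 0), (1, 1), (1, 2)),
       (qq^4, (0, 1), (1, 0), (1, 2))]"])
    (simp add: syzygy; simp add: ring_normal)+

lemma joinable_022: "joinable ((0, 0), (0, 2), (0, 2))"
  by (rule joinableI[of
      "[(qq^3, (0, 1), (0, 2), (0, 1)), (qq^8, (0, 2), (0, 2), (0, 0))]"
      _
      "[(qq, (0, 1), (0, 1), (0, 2)), (qq^4, (0, 2), (0, 0), (0, 2))]"])
    (simp add: syzygy; simp add: ring_normal)+

lemma joinable_100: "joinable ((1, 1), (0, 0), (0, 0))"
  by (rule joinableI[of
      "[(qq^4, (0, 0), (0, 0), (1, 1))]"
      _
      "[(qq^2, (0, 0), (1, 1), (0, 0))]"])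
    (simp add: syzygy; simp add: ring_normal)+

lemma joinable_101: "joinable ((1, 1), (0, 0), (0, 1))"
  by (rule joinableI[of
      "[(qq^2, (1, 1), (0, 1), (0, 0)), (qq^3 + qq^5, (0, 0), (0, 0), (1, 2)),
       (qq^4, (0, 0), (0, 1), (1, 1))]"
      _
      "[(qq^3 + qq^5, (1, 2), (0, 0), (0, 0)), (qq^2, (0, 0), (1, 1), (0, 1)),
       (qq^4, (0, 1), (1, 1), (0, 0))]"])
    (simp add: syzygy; simp add: ring_normal)+

lemma joinable_102: "joinable ((1, 1), (0, 0), (0, 2))"
  by (rule joinableI[of
      "[(qq, (1, 1), (0, 1), (0, 1)), (qq^4, (1, 1), (0, 2), (0, 0)),
       (qq^4, (1, 2), (0, 1), (0, 0)), (qq^2 + qq^4, (0, 0), (0, 1), (1, 2)),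
       (qq^4, (0, 0), (0, 2), (1, 1))]"
      _
      "[(qq^2 + qq^4, (1, 2), (0, 0), (0, 1)), (qq^2, (0, 0), (1, 1), (0, 2)),
       (qq^2, (0, 0), (1, 2), (0, 1)), (qq^3, (0, 1), (1, 1), (0, 1)),
       (qq^6, (0, 2), (1, 1), (0, 0))]"])
    (simp add: syzygy; simp add: ring_normal)+

lemma joinable_110: "joinable ((2, 1), (1, 1), (0, 0))"
  by (rule joinableI[of
      "[(qq^2, (2, 1), (0, 0), (1, 1)), (qq + qq^3, (2, 2), (0, 0), (1, 0)),
       (qq^2, (1, 0), (1, 1), (1, 1)), (qq^5 + qq^7, (1, 0), (0, 0), (2, 2)),
       (qq^4, (1, 1), (0, 0), (2, 1))]"
      _
      "[(qq + qq^3, (2, 2), (1, 0), (0, 0)), (qq + qq^3, (1, 0), (2, 2), (0, 0)),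
       (qq^2, (1, 1), (2, 1), (0, 0)), (qq^2, (1, 1), (1, 0), (1, 1)),
       (qq^4, (0, 0), (2, 1), (1, 1))]"])
    (simp add: syzygy; simp add: ring_normal)+

lemma joinable_111: "joinable ((2, 1), (1, 1), (0, 1))"
  by (rule joinableI[of
      "[(qq + qq^3, (2, 1), (1, 2), (0, 0)), (qq + qq^3, (2, 1), (0, 0), (1, 2)),
       (qq^2, (2, 1), (0, 1), (1, 1)), (qq - qq^5, (2, 2), (0, 0), (1, 1)),
       (qq^3 + qq^5, (2, 2), (0, 1), (1, 0)), (qq - qq^5, (1, 0), (1, 2), (1, 1)),
       (qq^3 + qq^5, (1, 0), (0, 1), (2, 2)), (qq^3 + qq^5 - qq^7 - qq^9, (1, 1), (1, 2), (1, 0)),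
       (qq^3 + qq^5 - qq^7 - qq^9, (1, 1), (0, 0), (2, 2)), (qq^4, (1, 1), (0, 1), (2, 1))]"
      _
      "[(qq + qq^3, (2, 2), (1, 0), (0, 1)), (qq + qq^3, (1, 0), (2, 2), (0, 1)),
       (qq^2, (1, 1), (2, 1), (0, 1)), (qq - qq^5, (1, 1), (2, 2), (0, 0)),
       (qq - qq^5, (1, 1), (1, 0), (1, 2)), (qq^3 + qq^5, (1, 2), (2, 1), (0, 0)),
       (qq^3 + qq^5 - qq^7 - qq^9, (1, 2), (1, 0), (1, 1)), (qq^3 + qq^5, (0, 0), (2, 1), (1, 2)),
       (qq^3 + qq^5 - qq^7 - qq^9, (0, 0), (2, 2), (1, 1)), (qq^4, (0, 1), (2, 1), (1, 1))]"])
    (simp add: syzygy; simp add: ring_normal)+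

lemma joinable_112: "joinable ((1, 1), (0, 1), (0, 2))"
  by (rule joinableI[of
      "[(qq^2, (1, 1), (0, 2), (0, 1)), (qq^2, (1, 2), (0, 1), (0, 1)),
       (qq^5 + qq^7, (1, 2), (0, 2), (0, 0)), (qq + qq^3, (0, 0), (0, 2), (1, 2)),
       (qq^4, (0, 1), (0, 2), (1, 1))]"
      _
      "[(qq + qq^3, (1, 2), (0, 0), (0, 2)), (qq + qq^3, (0, 0), (1, 2), (0, 2)),
       (qq^2, (0, 1), (1, 1), (0, 2)), (qq^2, (0, 1), (1, 2), (0, 1)),
       (qq^4, (0, 2), (1, 1), (0, 1))]"])
    (simp add: syzygy; simp add: ring_normal)+

lemma joinable_120: "joinable ((2, 1), (2, 2), (0, 0))"
  by (rule joinableI[of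
      "[(qq, (2, 1), (1, 1), (1, 1)), (qq^4, (2, 1), (0, 0), (2, 2)),
       (qq^2 + qq^4, (2, 2), (1, 1), (1, 0)), (qq^4, (2, 2), (0, 0), (2, 1)),
       (qq^4, (1, 0), (1, 1), (2, 2))]"
      _
      "[(qq^2, (2, 2), (2, 1), (0, 0)), (qq^2, (2, 2), (1, 0), (1, 1)),
       (qq^2 + qq^4, (1, 0), (2, 2), (1, 1)), (qq^3, (1, 1), (2, 1), (1, 1)),
       (qq^6, (0, 0), (2, 1), (2, 2))]"])
    (simp add: syzygy; simp add: ring_normal)+

lemma joinable_121: "joinable ((1, 1), (1, 2), (0, 1))"
  by (rule joinableI[of
      "[(qq^2, (1, 1), (0, 1), (1, 2)), (qq^3 + qq^5, (1, 2), (1, 2), (0, 0)),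
       (qq^4, (1, 2), (0, 1), (1, 1))]"
      _
      "[(qq^2, (1, 2), (1, 1), (0, 1)), (qq^3 + qq^5, (0, 0), (1, 2), (1, 2)),
       (qq^4, (0, 1), (1, 1), (1, 2))]"])
    (simp add: syzygy; simp add: ring_normal)+

lemma joinable_122: "joinable ((0, 1), (0, 2), (0, 2))"
  by (rule joinableI[of
      "[(qq^4, (0, 2), (0, 2), (0, 1))]"
      _
      "[(qq^2, (0, 2), (0, 1), (0, 2))]"])
    (simp add: syzygy; simp add: ring_normal)+

lemma joinable_200: "joinable ((2, 2), (0, 0), (0, 0))"
  by (rule joinableI[of
      "[(qq^3, (1, 1), (0, 0), (1, 1)), (qq^8, (0, 0), (0, 0), (2, 2))]"
      _
      "[(qq, (1, 1), (1, 1), (0, 0)), (qq^4, (0, 0), (2, 2), (0, 0))]"])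
    (simp add: syzygy; simp add: ring_normal)+

lemma joinable_201: "joinable ((2, 2), (0, 0), (0, 1))"
  by (rule joinableI[of
      "[(qq^2, (2, 2), (0, 1), (0, 0)), (qq^2, (1, 1), (1, 2), (0, 0)),
       (qq^2 + qq^4, (1, 1), (0, 0), (1, 2)), (qq^3, (1, 1), (0, 1), (1, 1)),
       (qq^6, (0, 0), (0, 1), (2, 2))]"
      _
      "[(qq, (1, 1), (1, 1), (0, 1)), (qq^2 + qq^4, (1, 2), (1, 1), (0, 0)),
       (qq^4, (0, 0), (2, 2), (0, 1)), (qq^4, (0, 0), (1, 1), (1, 2)),
       (qq^4, (0, 1), (2, 2), (0, 0))]"])
    (simp add: syzygy; simp add: ring_normal)+

lemma joinable_202: "joinable ((2, 2), (0, 0), (0, 2))"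
  by (rule joinableI[of
      "[(qq, (2, 2), (0, 1), (0, 1)), (qq^4, (2, 2), (0, 2), (0, 0)), (qq, (1, 1), (0, 1), (1, 2)),
       (qq^3, (1, 1), (0, 2), (1, 1)), (qq^2 - qq^4, (1, 2), (1, 2), (0, 0)),
       (qq^3 - qq^5, (1, 2), (0, 1), (1, 1)), (qq^4, (0, 0), (0, 2), (2, 2))]"
      _
      "[(qq, (1, 1), (1, 1), (0, 2)), (qq, (1, 2), (1, 1), (0, 1)), (qq^4, (0, 0), (2, 2), (0, 2)),
       (qq^2 - qq^4, (0, 0), (1, 2), (1, 2)), (qq^3, (0, 1), (2, 2), (0, 1)),
       (qq^3 - qq^5, (0, 1), (1, 1), (1, 2)), (qq^4, (0, 2), (2, 2), (0, 0))]"])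
    (simp add: syzygy; simp add: ring_normal)+

lemma joinable_210: "joinable ((2, 2), (1, 1), (0, 0))"
  by (rule joinableI[of
      "[(qq^2, (2, 2), (0, 0), (1, 1)), (qq^6, (1, 1), (0, 0), (2, 2))]"
      _
      "[(qq^2, (1, 1), (2, 2), (0, 0)), (qq^6, (0, 0), (2, 2), (1, 1))]"])
    (simp add: syzygy; simp add: ring_normal)+

lemma joinable_211: "joinable ((2, 2), (1, 1), (0, 1))"
  by (rule joinableI[of
      "[(qq + qq^3, (2, 2), (1, 2), (0, 0)), (qq + qq^3, (2, 2), (0, 0), (1, 2)),
       (qq^2, (2, 2), (0, 1), (1, 1)), (qq^2, (1, 1), (1, 2), (1, 1)),
       (qq^4, (1, 1), (0, 1), (2, 2))]"
      _
      "[(qq^2, (1, 1), (2, 2), (0, 1)), (qq^2, (1, 1), (1, 1), (1, 2)),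
       (qq + qq^3, (1, 2), (2, 2), (0, 0)), (qq^5 + qq^7, (0, 0), (2, 2), (1, 2)),
       (qq^4, (0, 1), (2, 2), (1, 1))]"])
    (simp add: syzygy; simp add: ring_normal)+

lemma joinable_212: "joinable ((1, 2), (0, 1), (0, 2))"
  by (rule joinableI[of
      "[(qq^2, (1, 2), (0, 2), (0, 1)), (qq^2, (0, 1), (0, 2), (1, 2))]"
      _
      "[(qq^2, (0, 1), (1, 2), (0, 2)), (qq^2, (0, 2), (1, 2), (0, 1))]"])
    (simp add: syzygy; simp add: ring_normal)+

lemma joinable_220: "joinable ((2, 2), (2, 2), (0, 0))"
  by (rule joinableI[of
      "[(qq, (2, 2), (1, 1), (1, 1)), (qq^4, (2, 2), (0, 0), (2, 2))]"
      _
      "[(qq^3, (1, 1), (2, 2), (1, 1)), (qq^8, (0, 0), (2, 2), (2, 2))]"])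
    (simp add: syzygy; simp add: ring_normal)+

lemma joinable_221: "joinable ((1, 2), (1, 2), (0, 1))"
  by (rule joinableI[of
      "[(qq^2, (1, 2), (0, 1), (1, 2))]"
      _
      "[(qq^4, (0, 1), (1, 2), (1, 2))]"])
    (simp add: syzygy; simp add: ring_normal)+

lemma joinable_222: "joinable ((0, 2), (0, 2), (0, 2))"
  by (rule joinableI[of
      "[]"
      _
      "[]"])
    (simp add: syzygy; simp add: ring_normal)+

lemma joinable_base:
  assumes "i \<le> 2" "j \<le> 2" "k \<le> 2"
  shows "joinable ((min (int i) (2 - int j) + min (int j) (2 - int k), i), (min (int j) (2 - int k), j), (0, k))"
proof -
  have "i \<in> {0, 1, 2}" "j \<in> {0, 1, 2}" "k \<in> {0, 1, 2}" using assms by auto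
  then show ?thesis
    by (elim insertE emptyE; hypsubst; simp add: joinable_000 joinable_001 joinable_002
        joinable_010 joinable_011 joinable_012 joinable_020 joinable_021 joinable_022
        joinable_100 joinable_101 joinable_102 joinable_110 joinable_111 joinable_112
        joinable_120 joinable_121 joinable_122 joinable_200 joinable_201 joinable_202
        joinable_210 joinable_211 joinable_212 joinable_220 joinable_221 joinable_222
        del: One_nat_def)
qed

section \<open>Multiplying syzygies by symmetric polynomials in three variables\<close>

definition dup :: "('b \<Rightarrow> 'b) \<Rightarrow> ('b \<Rightarrow> 'b) \<Rightarrow> ('k \<times> 'b) list \<Rightarrow> ('k \<times> 'b) list" where
  "dup f g \<alpha> = concat (map (\<lambda>(k, t). [(k, f t), (k, g t)]) \<alpha>)"

lemma val_dup: "val \<psi> (dup f g \<alpha>) = val (\<lambda>t. \<psi> (f t) + \<psi> (g t)) \<alpha>"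
  by (induction \<alpha>) (auto simp: dup_def algebra_simps)

lemma dup_mem: "(k, s) \<in> set (dup f g \<alpha>) \<Longrightarrow> \<exists>t. (k, t) \<in> set \<alpha> \<and> (s = f t \<or> s = g t)"
  unfolding dup_def by (induction \<alpha>) (auto simp del: split_paired_Ex)

text \<open>\<open>E\<close> composes a functional with multiplication by a symmetric polynomial p.
  On left relations p acts as \<open>f\<close> plus \<open>g\<close>, on right relations as
  \<open>f'\<close> plus \<open>g'\<close>, and each summand maps relations to relations. The new
  leading triple is \<open>f t = f' t\<close>; everything else is smaller and goes into the
  correction lists.\<close>

lemma joinable_step:
  assumes t: "joinable t" "left_bad t" "right_bad t"
    and f': "f' t = f t"
    and L: "\<And>\<psi> s. left_bad s \<Longrightarrow> left_val \<psi> (f s) + left_val \<psi> (g s) = left_val (E \<psi>) s"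
      "\<And>s. left_bad s \<Longrightarrow> left_bad (f s) \<and> left_bad (g s)"
    and R: "\<And>\<psi> s. right_bad s \<Longrightarrow> right_val \<psi> (f' s) + right_val \<psi> (g' s) = right_val (E \<psi>) s"
      "\<And>s. right_bad s \<Longrightarrow> right_bad (f' s) \<and> right_bad (g' s)"
    and less: "\<And>s. triple_less s t \<Longrightarrow> triple_less (f s) (f t) \<and> triple_less (f' s) (f t)"
      "\<And>s. s = t \<or> triple_less s t \<Longrightarrow> triple_less (g s) (f t) \<and> triple_less (g' s) (f t)"
  shows "joinable (f t)"
proof -
  obtain \<alpha> \<beta> where
    \<alpha>: "\<forall>(k, s) \<in> set \<alpha>. left_bad s \<and> triple_less s t" and
    \<beta>: "\<forall>(k, s) \<in> set \<beta>. right_bad s \<and> triple_less s t" and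
    eq: "\<And>\<psi>. val (left_val \<psi>) ((1, t) # \<alpha>) = val (right_val \<psi>) ((1, t) # \<beta>)"
    using t(1) unfolding joinable_def by blast
  show ?thesis
  proof (rule joinableI)
    \<comment> \<open>\<open>g t\<close> is the non-leading summand of p times the relation at
      \<open>t\<close>, hence one more correction term.\<close>
    show "\<forall>(k, s) \<in> set ((1, g t) # dup f g \<alpha>). left_bad s \<and> triple_less s (f t)"
    proof -
      have "left_bad s \<and> triple_less s (f t)" if s: "(k, s) \<in> set (dup f g \<alpha>)" for k s
      proof -
        obtain r where r: "(k, r) \<in> set \<alpha>" "s = f r \<or> s = g r" using dup_mem[OF s] by blast
        then have "left_bad r" "triple_less r t" using \<alpha> by blast+
        then show ?thesis using r(2) L(2) less by blast
      qed
      then show ?thesis using t(2) L(2) less(2) by auto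
    qed
    show "\<forall>(k, s) \<in> set ((1, g' t) # dup f' g' \<beta>). right_bad s \<and> triple_less s (f t)"
    proof -
      have "right_bad s \<and> triple_less s (f t)" if s: "(k, s) \<in> set (dup f' g' \<beta>)" for k s
      proof -
        obtain r where r: "(k, r) \<in> set \<beta>" "s = f' r \<or> s = g' r" using dup_mem[OF s] by blast
        then have "right_bad r" "triple_less r t" using \<beta> by blast+
        then show ?thesis using r(2) R(2) less by blast
      qed
      then show ?thesis using t(3) R(2) less(2) by auto
    qed
    fix \<psi>
    \<comment> \<open>The factor p moves into the functional: the enlarged list at \<psi> is the old
      list at \<open>E \<psi>\<close>, where the given syzygy applies.\<close>
    have "val (left_val \<psi>) ((1, f t) # (1, g t) # dup f g \<alpha>) = val (left_val (E \<psi>)) ((1, t) # \<alpha>)"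
    proof -
      have "val (\<lambda>t. left_val \<psi> (f t) + left_val \<psi> (g t)) \<alpha> = val (left_val (E \<psi>)) \<alpha>"
      proof (rule val_cong)
        fix k s assume "(k, s) \<in> set \<alpha>"
        then have "left_bad s" using \<alpha> by blast
        then show "left_val \<psi> (f s) + left_val \<psi> (g s) = left_val (E \<psi>) s" by (rule L(1))
      qed
      then show ?thesis by (simp add: val_dup L(1)[OF t(2), symmetric])
    qed
    also have "\<dots> = val (right_val (E \<psi>)) ((1, t) # \<beta>)" by (rule eq)
    also have "\<dots> = val (right_val \<psi>) ((1, f t) # (1, g' t) # dup f' g' \<beta>)"
    proof -
      have "val (\<lambda>t. right_val \<psi> (f' t) + right_val \<psi> (g' t)) \<beta> = val (right_val (E \<psi>)) \<beta>"
      proof (rule val_cong)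
        fix k s assume "(k, s) \<in> set \<beta>"
        then have "right_bad s" using \<beta> by blast
        then show "right_val \<psi> (f' s) + right_val \<psi> (g' s) = right_val (E \<psi>) s" by (rule R(1))
      qed
      then show ?thesis by (simp add: val_dup R(1)[OF t(3), symmetric] f')
    qed
    finally show "val (left_val \<psi>) ((1, f t) # (1, g t) # dup f g \<alpha>)
      = val (right_val \<psi>) ((1, f t) # (1, g' t) # dup f' g' \<beta>)" .
  qed
qed

text \<open>Multiplication by the first and by the second elementary symmetric polynomial in three
  variables, split as \<open>(z\<^sub>1 + z\<^sub>2) + z\<^sub>3\<close>, \<open>z\<^sub>1 z\<^sub>2 + (z\<^sub>1 + z\<^sub>2) z\<^sub>3\<close> on the left and as \<open>z\<^sub>1 + (z\<^sub>2 + z\<^sub>3)\<close>,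
  \<open>z\<^sub>1 (z\<^sub>2 + z\<^sub>3) + z\<^sub>2 z\<^sub>3\<close> on the right.\<close>

lemma joinable_sum1:
  assumes "bad a b" "bad b c" "joinable (a, b, c)"
  shows "joinable (zshift 1 a, b, c)"
proof -
  have "joinable ((\<lambda>(a, b, c). (zshift 1 a, b, c)) (a, b, c))"
  proof (rule joinable_step[where t = "(a, b, c)" and f = "\<lambda>(a, b, c). (zshift 1 a, b, c)"
        and f' = "\<lambda>(a, b, c). (zshift 1 a, b, c)"
        and g = "\<lambda>(a, b, c). (a, b, zshift 1 c)" and g' = "\<lambda>(a, b, c). (a, zshift 1 b, c)"
        and E = "\<lambda>\<psi> (a, b, c). \<psi> (zshift 1 a, b, c) + \<psi> (a, zshift 1 b, c) + \<psi> (a, b, zshift 1 c)"])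
  qed (use assms bad_ge[OF assms(1)] bad_ge[OF assms(2)] in
    \<open>auto simp: left_bad_def right_bad_def left_val_def right_val_def grel_esum val_esum
        val_add case_prod_unfold triple_less_def\<close>)
  then show ?thesis by simp
qed

lemma joinable_sum2:
  assumes "bad a b" "bad b c" "joinable (a, b, c)"
  shows "joinable (zshift 1 a, zshift 1 b, c)"
proof -
  have "joinable ((\<lambda>(a, b, c). (zshift 1 a, zshift 1 b, c)) (a, b, c))"
  proof (rule joinable_step[where t = "(a, b, c)" and f = "\<lambda>(a, b, c). (zshift 1 a, zshift 1 b, c)"
        and f' = "\<lambda>(a, b, c). (zshift 1 a, zshift 1 b, c)"
        and g = "\<lambda>(a, b, c). (zshift 1 a, b, zshift 1 c)" and g' = "\<lambda>(a, b, c). (a, zshift 1 b, zshift 1 c)"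
        and E = "\<lambda>\<psi> (a, b, c). \<psi> (zshift 1 a, zshift 1 b, c) + \<psi> (zshift 1 a, b, zshift 1 c) + \<psi> (a, zshift 1 b, zshift 1 c)"])
  qed (use assms bad_ge[OF assms(1)] bad_ge[OF assms(2)] in
    \<open>auto simp: left_bad_def right_bad_def left_val_def right_val_def grel_esum grel_shift
        val_esum val_shift2 val_add case_prod_unfold triple_less_def\<close>)
  then show ?thesis by simp
qed

text \<open>Multiplication by the m-th power of z1 z2 z3. As an invertible monomial it maps
  relations to relations one by one, for every integer m and without new correction terms.\<close>

lemma joinable_shift:
  assumes "joinable (a, b, c)"
  shows "joinable (zshift m a, zshift m b, zshift m c)"
proof -
  define f where "f = (\<lambda>(a, b, c). (zshift m a, zshift m b, zshift m c))"
  obtain \<alpha> \<beta> where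
    \<alpha>: "\<forall>(k, s) \<in> set \<alpha>. left_bad s \<and> triple_less s (a, b, c)" and
    \<beta>: "\<forall>(k, s) \<in> set \<beta>. right_bad s \<and> triple_less s (a, b, c)" and
    eq: "\<And>\<psi>. val (left_val \<psi>) ((1, a, b, c) # \<alpha>) = val (right_val \<psi>) ((1, a, b, c) # \<beta>)"
    using assms unfolding joinable_def by blast
  have f: "f (x, y, z) = (zshift m x, zshift m y, zshift m z)" for x y z by (simp add: f_def)
  have "left_val \<psi> (f (x, y, z)) = left_val (\<psi> \<circ> f) (x, y, z)"
    "right_val \<psi> (f (x, y, z)) = right_val (\<psi> \<circ> f) (x, y, z)" for \<psi> x y z
    by (simp_all add: f left_val_def right_val_def grel_shift val_shift2 case_prod_unfold)
  then have LR: "left_val \<psi> (f t) = left_val (\<psi> \<circ> f) t" "right_val \<psi> (f t) = right_val (\<psi> \<circ> f) t" for \<psi> t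
    by (metis prod_cases3)+
  have val_map: "val \<psi> (map (\<lambda>(k, t). (k, f t)) \<gamma>) = val (\<lambda>t. \<psi> (f t)) \<gamma>" for \<psi> :: "triple \<Rightarrow> K" and \<gamma>
    by (induction \<gamma>) auto
  have "joinable (f (a, b, c))"
  proof (rule joinableI)
    show "\<forall>(k, s) \<in> set (map (\<lambda>(k, t). (k, f t)) \<alpha>). left_bad s \<and> triple_less s (f (a, b, c))"
    proof -
      have "left_bad (f s) \<and> triple_less (f s) (f (a, b, c))" if "(k, s) \<in> set \<alpha>" for k s
      proof -
        have "left_bad s \<and> triple_less s (a, b, c)" using \<alpha> that by blast
        then show ?thesis by (cases s) (simp add: f left_bad_def triple_less_def del: zshift_simps(3))
      qed
      then show ?thesis by auto
    qed
    show "\<forall>(k, s) \<in> set (map (\<lambda>(k, t). (k, f t)) \<beta>). right_bad s \<and> triple_less s (f (a, b, c))"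
    proof -
      have "right_bad (f s) \<and> triple_less (f s) (f (a, b, c))" if "(k, s) \<in> set \<beta>" for k s
      proof -
        have "right_bad s \<and> triple_less s (a, b, c)" using \<beta> that by blast
        then show ?thesis by (cases s) (simp add: f right_bad_def triple_less_def del: zshift_simps(3))
      qed
      then show ?thesis by auto
    qed
    show "val (left_val \<psi>) ((1, f (a, b, c)) # map (\<lambda>(k, t). (k, f t)) \<alpha>)
      = val (right_val \<psi>) ((1, f (a, b, c)) # map (\<lambda>(k, t). (k, f t)) \<beta>)" for \<psi>
      using eq[of "\<psi> \<circ> f"] by (simp add: val_map LR)
  qed
  then show ?thesis by (simp add: f)
qed

lemma joinable: "bad a b \<Longrightarrow> bad b c \<Longrightarrow> joinable (a, b, c)"
  by (induction rule: bad2_induct)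
    (blast intro: joinable_base joinable_sum1 joinable_sum2 joinable_shift)+

lemma triple_less_word_less: "triple_less (a', b', c') (a, b, c) \<Longrightarrow> ([a', b', c'], [a, b, c]) \<in> word_less"
  by (auto simp: triple_less_def word_less_def)

interpretation wedge: quadratic_rewriting word_less bad grel
proof
  show "wf word_less" by (rule wf_word_less)
  show "(u @ M @ v, u @ L @ v) \<in> word_less" if "(M, L) \<in> word_less" for M L u v
    using that by (rule word_less_context)
  show "\<exists>r. grel c d = (1, c, d) # r \<and> (\<forall>(k, c', d')\<in>set r. ([c', d'], [c, d]) \<in> word_less)"
    if "bad c d" for c d
    using grel_lead[OF that] by (blast intro: lower_word_less)
  fix a b c assume "bad a b" "bad b c"
  then have "joinable (a, b, c)" by (rule joinable)
  then obtain \<alpha> \<beta> where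
    \<alpha>: "\<forall>(k, s) \<in> set \<alpha>. left_bad s \<and> triple_less s (a, b, c)" and
    \<beta>: "\<forall>(k, s) \<in> set \<beta>. right_bad s \<and> triple_less s (a, b, c)" and
    eq: "\<And>\<psi>. val (left_val \<psi>) ((1, a, b, c) # \<alpha>) = val (right_val \<psi>) ((1, a, b, c) # \<beta>)"
    unfolding joinable_def by blast
  show "\<exists>\<alpha> \<beta>.
      (\<forall>(k, a', b', c') \<in> set \<alpha>. bad a' b' \<and> ([a', b', c'], [a, b, c]) \<in> word_less) \<and>
      (\<forall>(k, a', b', c') \<in> set \<beta>. bad b' c' \<and> ([a', b', c'], [a, b, c]) \<in> word_less) \<and>
      (\<forall>\<psi>. val (\<lambda>(a, b, c). val (\<lambda>(x, y). \<psi> (x, y, c)) (grel a b)) ((1, a, b, c) # \<alpha>)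
         = val (\<lambda>(a, b, c). val (\<lambda>(x, y). \<psi> (a, x, y)) (grel b c)) ((1, a, b, c) # \<beta>))"
  proof (intro exI conjI)
    show "\<forall>(k, a', b', c') \<in> set \<alpha>. bad a' b' \<and> ([a', b', c'], [a, b, c]) \<in> word_less"
      using \<alpha> unfolding left_bad_def by (blast intro: triple_less_word_less)
    show "\<forall>(k, a', b', c') \<in> set \<beta>. bad b' c' \<and> ([a', b', c'], [a, b, c]) \<in> word_less"
      using \<beta> unfolding right_bad_def by (blast intro: triple_less_word_less)
    show "\<forall>\<psi>. val (\<lambda>(a, b, c). val (\<lambda>(x, y). \<psi> (x, y, c)) (grel a b)) ((1, a, b, c) # \<alpha>)
         = val (\<lambda>(a, b, c). val (\<lambda>(x, y). \<psi> (a, x, y)) (grel b c)) ((1, a, b, c) # \<beta>)"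
      using eq unfolding left_val_def right_val_def by blast
  qed
qed

section \<open>The space of relations\<close>

text \<open>A power of \<open>qq\<close> is a power of the polynomial variable, so evaluation at 0
  would give 0 = 1. Since \<open>qq\<close> is no root of unity, the quantum integers [2], [3], [4]
  are invertible in \<open>vec2_grel_Nsp\<close>.\<close>

lemma qq_power_neq_1:
  assumes "0 < n" shows "qq ^ n \<noteq> 1"
proof
  have pow: "qq ^ m = Fract ([:0, 1:] ^ m) 1" for m
    by (induction m) (simp_all add: qq_def One_fract_def)
  assume "qq ^ n = 1"
  then have "[:0, 1:] ^ n = (1 :: rat poly)"
    by (simp add: pow One_fract_def eq_fract)
  then have "poly ([:0, 1:] ^ n) 0 = (1 :: rat)" by simp
  then show False using assms by (simp add: poly_power power_0_left)
qed

lemma qq_neq_0 [simp]: "qq \<noteq> 0"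
  by (simp add: qq_def Zero_fract_def eq_fract)

lemma qq_square_neq [simp]: "qq * qq \<noteq> 1"
  using qq_power_neq_1[of 2] by (simp add: power2_eq_square)

text \<open>Only [1] and [2] occur as matrix coefficients on V; [2] is given for both forms of the
  numeral.\<close>

lemma qint_simps: "qint (Suc 0) = 1" "qint 2 = (1 + qq^2) / qq" "qint (Suc (Suc 0)) = (1 + qq^2) / qq"
proof -
  have "qq - inverse qq \<noteq> 0" using qq_square_neq by (auto simp: field_simps)
  then show "qint (Suc 0) = 1" by (simp add: qint_def)
  have "qint 2 = (qq + inverse qq) * (qq - inverse qq) / (qq - inverse qq)"
    unfolding qint_def by (simp add: algebra_simps power2_eq_square)
  also have "\<dots> = (1 + qq^2) / qq" using \<open>qq - inverse qq \<noteq> 0\<close>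
    by (simp add: power2_eq_square field_simps)
  finally show "qint 2 = (1 + qq^2) / qq" .
  then show "qint (Suc (Suc 0)) = (1 + qq^2) / qq" by (simp only: numeral_2_eq_2)
qed

section \<open>The action of the generators on V and V \<otimes> V, and the annihilator of the
  relations\<close>

definition e_act :: "nat \<Rightarrow> bas \<Rightarrow> (K \<times> bas) list" where
  "e_act i = (\<lambda>(a, j).
     if i = 0 then (if j \<le> 1 then [(qint (j + 1), (a + 1, j + 1))] else [])
     else (if 1 \<le> j then [(qint (3 - j), (a, j - 1))] else []))"

definition f_act :: "nat \<Rightarrow> bas \<Rightarrow> (K \<times> bas) list" where
  "f_act i = (\<lambda>(a, j).
     if i = 0 then (if 1 \<le> j then [(qint (3 - j), (a - 1, j - 1))] else [])
     else (if j \<le> 1 then [(qint (j + 1), (a, j + 1))] else []))"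

text \<open>The coproduct in list form; \<open>eT_pair\<close> and \<open>fT_pair\<close> identify
  it with the operators \<open>eT\<close> and \<open>fT\<close> on words of length two.\<close>

definition e_act2 :: "nat \<Rightarrow> bas \<times> bas \<Rightarrow> (K \<times> bas \<times> bas) list" where
  "e_act2 i = (\<lambda>(c, d). map (\<lambda>(k, x). (k, x, d)) (e_act i c) @
     map (\<lambda>(k, y). (inverse (tq i c) * k, c, y)) (e_act i d))"

definition f_act2 :: "nat \<Rightarrow> bas \<times> bas \<Rightarrow> (K \<times> bas \<times> bas) list" where
  "f_act2 i = (\<lambda>(c, d). map (\<lambda>(k, x). (tq i d * k, x, d)) (f_act i c) @
     map (\<lambda>(k, y). (k, c, y)) (f_act i d))"

text \<open>Stability of the span of all \<open>grel c d\<close> under an operator is treated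
  dually, as stability of this set of functionals under composition with the operator.\<close>

definition annihilates :: "(bas \<times> bas \<Rightarrow> K) \<Rightarrow> bool" where
  "annihilates \<psi> \<longleftrightarrow> (\<forall>c d. bad c d \<longrightarrow> val \<psi> (grel c d) = 0)"

text \<open>Multiplication by x + y carries the relation of a bad pair to the relation of the pair
  \<open>(zshift 1 c, d)\<close>, which is bad again.\<close>

lemma annihilates_sum:
  assumes "annihilates \<psi>"
  shows "annihilates (\<lambda>(c, d). \<psi> (zshift 1 c, d) + \<psi> (c, zshift 1 d))"
  unfolding annihilates_def
proof (intro allI impI)
  fix c d assume "bad c d"
  then have "val (\<lambda>(c, d). \<psi> (zshift 1 c, d) + \<psi> (c, zshift 1 d)) (grel c d) = val \<psi> (grel (zshift 1 c) d)"
    by (simp only: grel_esum val_esum)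
  then show "val (\<lambda>(c, d). \<psi> (zshift 1 c, d) + \<psi> (c, zshift 1 d)) (grel c d) = 0"
    using assms bad_zshift(1)[OF \<open>bad c d\<close>, of 1] by (simp only: annihilates_def)
qed

lemma annihilates_shift:
  assumes "annihilates \<psi>"
  shows "annihilates (\<lambda>(c, d). \<psi> (zshift b c, zshift b d))"
  unfolding annihilates_def
proof (intro allI impI)
  fix c d assume "bad c d"
  have "val (\<lambda>(c, d). \<psi> (zshift b c, zshift b d)) (grel c d) = val \<psi> (grel (zshift b c) (zshift b d))"
    by (simp only: grel_shift val_shift2)
  then show "val (\<lambda>(c, d). \<psi> (zshift b c, zshift b d)) (grel c d) = 0"
    using assms bad_zshift(2)[of b c d] \<open>bad c d\<close> by (simp only: annihilates_def)
qed

text \<open>An operator commuting with x + y and with the powers of x y preserves the span of the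
  relations as soon as it sends the nine generators into it.\<close>

lemma annihilates_transpose:
  assumes sum: "\<And>\<psi> c d. val \<psi> (\<tau> (zshift 1 c, d)) + val \<psi> (\<tau> (c, zshift 1 d)) =
      val (\<lambda>(c, d). \<psi> (zshift 1 c, d) + \<psi> (c, zshift 1 d)) (\<tau> (c, d))"
    and shift: "\<And>\<psi> b c d. val \<psi> (\<tau> (zshift b c, zshift b d)) = val (\<lambda>(c, d). \<psi> (zshift b c, zshift b d)) (\<tau> (c, d))"
    and base: "\<And>\<psi> i j. annihilates \<psi> \<Longrightarrow> i \<in> {0, 1, 2} \<Longrightarrow> j \<in> {0, 1, 2} \<Longrightarrow>
      val (\<lambda>p. val \<psi> (\<tau> p)) (Crel i j) = 0"
    and \<psi>: "annihilates \<psi>"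
  shows "annihilates (\<lambda>p. val \<psi> (\<tau> p))"
proof -
  \<comment> \<open>The functional is quantified inside the induction, since the sum and shift cases
    use the hypothesis for a modified functional.\<close>
  have "\<forall>\<psi>. annihilates \<psi> \<longrightarrow> val (\<lambda>p. val \<psi> (\<tau> p)) (grel c d) = 0" if "bad c d" for c d
    using that
  proof (induction rule: bad_induct)
    case (base i j)
    have "i \<in> {0, 1, 2}" "j \<in> {0, 1, 2}" using base by auto
    then show ?case using assms(3) by (simp only: grel_base[OF base]) blast
  next
    case (sum c d)
    have "val (\<lambda>p. val \<psi> (\<tau> p)) (esum (grel c d)) =
        val (\<lambda>p. val (\<lambda>(c, d). \<psi> (zshift 1 c, d) + \<psi> (c, zshift 1 d)) (\<tau> p)) (grel c d)" for \<psi>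
      unfolding val_esum by (rule val_cong) (auto simp only: assms(1) split: prod.splits)
    then show ?case using sum annihilates_sum by (auto simp only: grel_esum)
  next
    case (shift b c d)
    have "val (\<lambda>p. val \<psi> (\<tau> p)) (shift2 b (grel c d)) =
        val (\<lambda>p. val (\<lambda>(c, d). \<psi> (zshift b c, zshift b d)) (\<tau> p)) (grel c d)" for \<psi>
      unfolding val_shift2 by (rule val_cong) (auto simp only: assms(2) split: prod.splits)
    then show ?case using shift annihilates_shift by (auto simp only: grel_shift)
  qed
  then show ?thesis using \<psi> by (simp add: annihilates_def)
qed

lemmas action = e_act2_def f_act2_def e_act_def f_act_def tq_def hw_def qint_simps
  Crel_def grel_def Henergy_def power_int_minus

text \<open>This and the next three lemmas express the images of the nine generators in the
  relations themselves. A pair of negative energy stands for a multiple by x + y, for instance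
  \<open>(2, 2), (0, 1)\<close> for x + y times the generator with indices 2, 1. The fractions are
  [2], [3] and [4].\<close>

lemma e0_Crel:
  fixes \<psi> :: "bas \<times> bas \<Rightarrow> K"
  shows
    "val (\<lambda>p. val \<psi> (e_act2 0 p)) (Crel 0 0) = val (\<lambda>(c, d). val \<psi> (grel c d)) [(1, (1, 1), (0, 0))]"
    "val (\<lambda>p. val \<psi> (e_act2 0 p)) (Crel 0 1) = val (\<lambda>(c, d). val \<psi> (grel c d)) [(1, (1, 1), (0, 1))]"
    "val (\<lambda>p. val \<psi> (e_act2 0 p)) (Crel 1 0) = val (\<lambda>(c, d). val \<psi> (grel c d)) [((1 + qq^2) / qq, (2, 2), (0, 0))]"
    "val (\<lambda>p. val \<psi> (e_act2 0 p)) (Crel 0 2) = val (\<lambda>(c, d). val \<psi> (grel c d)) [(1, (1, 1), (0, 2)), (1, (1, 2), (0, 1))]"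
    "val (\<lambda>p. val \<psi> (e_act2 0 p)) (Crel 1 1) = val (\<lambda>(c, d). val \<psi> (grel c d)) [((1 + qq^2) / qq, (2, 2), (0, 1)), ((1 + qq^2) / qq, (1, 1), (1, 2))]"
    "val (\<lambda>p. val \<psi> (e_act2 0 p)) (Crel 2 0) = val (\<lambda>(c, d). val \<psi> (grel c d)) [((1 + qq^2 + qq^4) / qq^2, (2, 2), (1, 1))]"
    "val (\<lambda>p. val \<psi> (e_act2 0 p)) (Crel 1 2) = val (\<lambda>(c, d). val \<psi> (grel c d)) [((1 + qq^2) / qq, (1, 2), (0, 2))]"
    "val (\<lambda>p. val \<psi> (e_act2 0 p)) (Crel 2 1) = val (\<lambda>(c, d). val \<psi> (grel c d)) [((1 + qq^2 + qq^4 + qq^6) / qq^3, (1, 2), (1, 2))]"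
    "val (\<lambda>p. val \<psi> (e_act2 0 p)) (Crel 2 2) = val (\<lambda>(c, d). val \<psi> (grel c d)) []"
  by (simp add: action; simp add: field_simps eval_nat_numeral)+

lemma e1_Crel:
  fixes \<psi> :: "bas \<times> bas \<Rightarrow> K"
  shows
    "val (\<lambda>p. val \<psi> (e_act2 1 p)) (Crel 0 0) = val (\<lambda>(c, d). val \<psi> (grel c d)) []"
    "val (\<lambda>p. val \<psi> (e_act2 1 p)) (Crel 0 1) = val (\<lambda>(c, d). val \<psi> (grel c d)) [((1 + qq^2 + qq^4 + qq^6) / qq^3, (0, 0), (0, 0))]"
    "val (\<lambda>p. val \<psi> (e_act2 1 p)) (Crel 1 0) = val (\<lambda>(c, d). val \<psi> (grel c d)) [((1 + qq^2) / qq, (1, 0), (0, 0))]"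
    "val (\<lambda>p. val \<psi> (e_act2 1 p)) (Crel 0 2) = val (\<lambda>(c, d). val \<psi> (grel c d)) [((1 + qq^2 + qq^4) / qq^2, (0, 0), (0, 1))]"
    "val (\<lambda>p. val \<psi> (e_act2 1 p)) (Crel 1 1) = val (\<lambda>(c, d). val \<psi> (grel c d)) [((1 + qq^2) / qq, (1, 0), (0, 1)), ((1 + qq^2) / qq, (1, 1), (0, 0))]"
    "val (\<lambda>p. val \<psi> (e_act2 1 p)) (Crel 2 0) = val (\<lambda>(c, d). val \<psi> (grel c d)) [(1, (2, 1), (0, 0)), (1, (1, 0), (1, 1))]"
    "val (\<lambda>p. val \<psi> (e_act2 1 p)) (Crel 1 2) = val (\<lambda>(c, d). val \<psi> (grel c d)) [((1 + qq^2) / qq, (0, 0), (0, 2))]"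
    "val (\<lambda>p. val \<psi> (e_act2 1 p)) (Crel 2 1) = val (\<lambda>(c, d). val \<psi> (grel c d)) [(1, (1, 1), (0, 1))]"
    "val (\<lambda>p. val \<psi> (e_act2 1 p)) (Crel 2 2) = val (\<lambda>(c, d). val \<psi> (grel c d)) [(1, (0, 1), (0, 2))]"
  by (simp add: action; simp add: field_simps eval_nat_numeral)+

lemma f0_Crel:
  fixes \<psi> :: "bas \<times> bas \<Rightarrow> K"
  shows
    "val (\<lambda>p. val \<psi> (f_act2 0 p)) (Crel 0 0) = val (\<lambda>(c, d). val \<psi> (grel c d)) []"
    "val (\<lambda>p. val \<psi> (f_act2 0 p)) (Crel 0 1) = val (\<lambda>(c, d). val \<psi> (grel c d)) [((1 + qq^2) / qq, (0, 0), (-1, 0))]"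
    "val (\<lambda>p. val \<psi> (f_act2 0 p)) (Crel 1 0) = val (\<lambda>(c, d). val \<psi> (grel c d)) [((1 + qq^2 + qq^4 + qq^6) / qq^3, (0, 0), (0, 0))]"
    "val (\<lambda>p. val \<psi> (f_act2 0 p)) (Crel 0 2) = val (\<lambda>(c, d). val \<psi> (grel c d)) [(1, (0, 0), (-1, 1)), (1, (0, 1), (-1, 0))]"
    "val (\<lambda>p. val \<psi> (f_act2 0 p)) (Crel 1 1) = val (\<lambda>(c, d). val \<psi> (grel c d)) [((1 + qq^2) / qq, (1, 1), (-1, 0)), ((1 + qq^2) / qq, (0, 0), (0, 1))]"
    "val (\<lambda>p. val \<psi> (f_act2 0 p)) (Crel 2 0) = val (\<lambda>(c, d). val \<psi> (grel c d)) [((1 + qq^2 + qq^4) / qq^2, (1, 1), (0, 0))]"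
    "val (\<lambda>p. val \<psi> (f_act2 0 p)) (Crel 1 2) = val (\<lambda>(c, d). val \<psi> (grel c d)) [(1, (0, 1), (-1, 1))]"
    "val (\<lambda>p. val \<psi> (f_act2 0 p)) (Crel 2 1) = val (\<lambda>(c, d). val \<psi> (grel c d)) [((1 + qq^2) / qq, (1, 2), (-1, 0))]"
    "val (\<lambda>p. val \<psi> (f_act2 0 p)) (Crel 2 2) = val (\<lambda>(c, d). val \<psi> (grel c d)) [(1, (0, 2), (-1, 1))]"
  by (simp add: action; simp add: field_simps eval_nat_numeral)+

text \<open>From \<open>Crel 0 0\<close> the operator f_1 runs through \<open>Crel 0 1\<close>,
  \<open>Crel 0 2\<close>, \<open>Crel 1 2\<close>, \<open>Crel 2 2\<close> with coefficients 1,
  [2], [3], [4]; \<open>vec2_grel_Nsp\<close> follows this chain.\<close>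

lemma f1_Crel:
  fixes \<psi> :: "bas \<times> bas \<Rightarrow> K"
  shows
    "val (\<lambda>p. val \<psi> (f_act2 1 p)) (Crel 0 0) = val (\<lambda>(c, d). val \<psi> (grel c d)) [(1, (0, 0), (0, 1))]"
    "val (\<lambda>p. val \<psi> (f_act2 1 p)) (Crel 0 1) = val (\<lambda>(c, d). val \<psi> (grel c d)) [((1 + qq^2) / qq, (0, 0), (0, 2))]"
    "val (\<lambda>p. val \<psi> (f_act2 1 p)) (Crel 1 0) = val (\<lambda>(c, d). val \<psi> (grel c d)) [(1, (1, 1), (0, 1))]"
    "val (\<lambda>p. val \<psi> (f_act2 1 p)) (Crel 0 2) = val (\<lambda>(c, d). val \<psi> (grel c d)) [((1 + qq^2 + qq^4) / qq^2, (0, 1), (0, 2))]"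
    "val (\<lambda>p. val \<psi> (f_act2 1 p)) (Crel 1 1) = val (\<lambda>(c, d). val \<psi> (grel c d)) [((1 + qq^2) / qq, (1, 1), (0, 2)), ((1 + qq^2) / qq, (1, 2), (0, 1))]"
    "val (\<lambda>p. val \<psi> (f_act2 1 p)) (Crel 2 0) = val (\<lambda>(c, d). val \<psi> (grel c d)) [(1, (2, 2), (0, 1)), (1, (1, 1), (1, 2))]"
    "val (\<lambda>p. val \<psi> (f_act2 1 p)) (Crel 1 2) = val (\<lambda>(c, d). val \<psi> (grel c d)) [((1 + qq^2 + qq^4 + qq^6) / qq^3, (0, 2), (0, 2))]"
    "val (\<lambda>p. val \<psi> (f_act2 1 p)) (Crel 2 1) = val (\<lambda>(c, d). val \<psi> (grel c d)) [((1 + qq^2) / qq, (1, 2), (0, 2))]"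
    "val (\<lambda>p. val \<psi> (f_act2 1 p)) (Crel 2 2) = val (\<lambda>(c, d). val \<psi> (grel c d)) []"
  by (simp add: action; simp add: field_simps eval_nat_numeral)+

text \<open>The generator commutes with z on either factor, because its coefficients and
  \<open>tq\<close> depend only on the index; so \<open>annihilates_transpose\<close> reduces the
  claim to the nine generators.\<close>

lemma annihilates_e:
  assumes "i \<in> {0, 1}" "annihilates \<psi>"
  shows "annihilates (\<lambda>p. val \<psi> (e_act2 i p))"
proof (rule annihilates_transpose[OF _ _ _ assms(2)])
  fix \<psi> :: "bas \<times> bas \<Rightarrow> K" and b and c d :: bas
  show "val \<psi> (e_act2 i (zshift 1 c, d)) + val \<psi> (e_act2 i (c, zshift 1 d)) =
      val (\<lambda>(c, d). \<psi> (zshift 1 c, d) + \<psi> (c, zshift 1 d)) (e_act2 i (c, d))"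
    by (cases c; cases d) (simp add: e_act2_def e_act_def tq_def algebra_simps)
  show "val \<psi> (e_act2 i (zshift b c, zshift b d)) = val (\<lambda>(c, d). \<psi> (zshift b c, zshift b d)) (e_act2 i (c, d))"
    by (cases c; cases d) (simp add: e_act2_def e_act_def tq_def algebra_simps)
next
  fix \<psi> :: "bas \<times> bas \<Rightarrow> K" and j k :: nat
  assume "annihilates \<psi>" "j \<in> {0, 1, 2}" "k \<in> {0, 1, 2}"
  then have "\<And>c d. bad c d \<Longrightarrow> val \<psi> (grel c d) = 0" unfolding annihilates_def by blast
  then show "val (\<lambda>p. val \<psi> (e_act2 i p)) (Crel j k) = 0"
    using assms(1) \<open>j \<in> {0, 1, 2}\<close> \<open>k \<in> {0, 1, 2}\<close>
    by (elim insertE emptyE; hypsubst; simp only: e0_Crel e1_Crel; simp add: bad_def Henergy_def)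
qed

lemma annihilates_f:
  assumes "i \<in> {0, 1}" "annihilates \<psi>"
  shows "annihilates (\<lambda>p. val \<psi> (f_act2 i p))"
proof (rule annihilates_transpose[OF _ _ _ assms(2)])
  fix \<psi> :: "bas \<times> bas \<Rightarrow> K" and b and c d :: bas
  show "val \<psi> (f_act2 i (zshift 1 c, d)) + val \<psi> (f_act2 i (c, zshift 1 d)) =
      val (\<lambda>(c, d). \<psi> (zshift 1 c, d) + \<psi> (c, zshift 1 d)) (f_act2 i (c, d))"
    by (cases c; cases d) (simp add: f_act2_def f_act_def tq_def algebra_simps)
  show "val \<psi> (f_act2 i (zshift b c, zshift b d)) = val (\<lambda>(c, d). \<psi> (zshift b c, zshift b d)) (f_act2 i (c, d))"
    by (cases c; cases d) (simp add: f_act2_def f_act_def tq_def algebra_simps)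
next
  fix \<psi> :: "bas \<times> bas \<Rightarrow> K" and j k :: nat
  assume "annihilates \<psi>" "j \<in> {0, 1, 2}" "k \<in> {0, 1, 2}"
  then have "\<And>c d. bad c d \<Longrightarrow> val \<psi> (grel c d) = 0" unfolding annihilates_def by blast
  then show "val (\<lambda>p. val \<psi> (f_act2 i p)) (Crel j k) = 0"
    using assms(1) \<open>j \<in> {0, 1, 2}\<close> \<open>k \<in> {0, 1, 2}\<close>
    by (elim insertE emptyE; hypsubst; simp only: f0_Crel f1_Crel; simp add: bad_def Henergy_def)
qed

definition qh_weight :: "int \<times> int \<times> int \<Rightarrow> bas \<times> bas \<Rightarrow> int" where
  "qh_weight = (\<lambda>(m\<^sub>0, m\<^sub>1, m) (c, d). m\<^sub>0 * (hw 0 (snd c) + hw 0 (snd d))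
     + m\<^sub>1 * (hw 1 (snd c) + hw 1 (snd d)) + m * (fst c + fst d))"

text \<open>Each \<open>grel c d\<close> is a weight vector, because the weight depends only on the
  exponent sum and the index sum, which \<open>lower\<close> conserves. Composition with the
  operator therefore only rescales the value.\<close>

lemma annihilates_qh:
  assumes "annihilates \<psi>"
  shows "annihilates (\<lambda>p. qq powi qh_weight h p * \<psi> p)"
  unfolding annihilates_def
proof (intro allI impI)
  fix c d assume cd: "bad c d"
  obtain r where r: "grel c d = (1, c, d) # r" "\<forall>(k, c', d') \<in> set r. lower c d c' d'"
    using grel_lead[OF cd] by blast
  obtain m0 m1 m where h: "h = (m0, m1, m)" by (rule prod_cases3)
  have "qh_weight h p = qh_weight h (c, d)" if "(k, p) \<in> set (grel c d)" for k p
  proof -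
    obtain c' d' where p: "p = (c', d')" by (rule prod.exhaust)
    have "(c', d') = (c, d) \<or> lower c d c' d'" using that r p by auto
    then have *: "fst c' + fst d' = fst c + fst d" "snd c' + snd d' = snd c + snd d"
      by (auto simp: lower_def)
    have "qh_weight h (x, y) = m0 * (2 * int (snd x + snd y) - 4)
        + m1 * (4 - 2 * int (snd x + snd y)) + m * (fst x + fst y)" for x y
      by (simp add: qh_weight_def h hw_def algebra_simps)
    then show ?thesis by (simp only: p *)
  qed
  then have "val (\<lambda>p. qq powi qh_weight h p * \<psi> p) (grel c d)
      = val (\<lambda>p. qq powi qh_weight h (c, d) * \<psi> p) (grel c d)"
    by (intro val_cong) simp
  then show "val (\<lambda>p. qq powi qh_weight h p * \<psi> p) (grel c d) = 0"
    using assms cd unfolding annihilates_def val_mult by (metis mult_zero_right)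
qed

section \<open>From formal combinations to coefficient functions\<close>

definition vec_of :: "(K \<times> bas list) list \<Rightarrow> vec" where
  "vec_of \<alpha> = (\<lambda>M. val (\<lambda>w. delta w M) \<alpha>)"

lemma vec_of_support: "{M. vec_of \<alpha> M \<noteq> 0} \<subseteq> snd ` set \<alpha>"
proof clarify
  fix M assume "vec_of \<alpha> M \<noteq> 0"
  then obtain k w where "(k, w) \<in> set \<alpha>" "delta w M \<noteq> 0"
    unfolding vec_of_def using val_eq_0[of \<alpha> "\<lambda>w. delta w M"] by blast
  then show "M \<in> snd ` set \<alpha>" by (force simp: delta_def split: if_splits)
qed

text \<open>Coefficients of repeated words add up, so the value depends only on the represented
  function. The freedom in \<open>S\<close> allows two representations to be compared on a common
  finite set of words.\<close>

lemma val_vec_of: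
  assumes "finite S" "snd ` set \<alpha> \<subseteq> S"
  shows "val \<phi> \<alpha> = (\<Sum>L\<in>S. vec_of \<alpha> L * \<phi> L)"
proof -
  have "(\<Sum>L\<in>S. vec_of \<alpha> L * \<phi> L) = (\<Sum>L\<in>S. val (\<lambda>w. \<phi> L * delta w L) \<alpha>)"
    by (simp add: vec_of_def val_mult mult.commute)
  also have "\<dots> = val (\<lambda>w. \<Sum>L\<in>S. \<phi> L * delta w L) \<alpha>"
    using assms(1) by (simp add: val_sum)
  also have "\<dots> = val \<phi> \<alpha>"
  proof (rule val_cong)
    fix k w assume "(k, w) \<in> set \<alpha>"
    then have "w \<in> S" using assms(2) by force
    then show "(\<Sum>L\<in>S. \<phi> L * delta w L) = \<phi> w"
      using assms(1) by (simp add: delta_def if_distrib[of "\<lambda>x. _ * x"] cong: if_cong)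
  qed
  finally show ?thesis by simp
qed

lemma lin_vec_of: "lin T (vec_of \<alpha>) = (\<lambda>M. val (\<lambda>w. T w M) \<alpha>)"
proof
  fix M
  have "lin T (vec_of \<alpha>) M = (\<Sum>L\<in>snd ` set \<alpha>. vec_of \<alpha> L * T L M)"
    unfolding lin_def using vec_of_support[of \<alpha>] by (intro sum.mono_neutral_left) auto
  then show "lin T (vec_of \<alpha>) M = val (\<lambda>w. T w M) \<alpha>"
    using val_vec_of[of "snd ` set \<alpha>" \<alpha> "\<lambda>w. T w M"] by simp
qed

definition vec2 :: "(K \<times> bas \<times> bas) list \<Rightarrow> vec" where
  "vec2 \<alpha> = (\<lambda>M. val (\<lambda>(c, d). delta [c, d] M) \<alpha>)"

definition bind :: "('k::comm_ring_1 \<times> 'b) list \<Rightarrow> ('b \<Rightarrow> ('k \<times> 'c) list) \<Rightarrow> ('k \<times> 'c) list" where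
  "bind \<alpha> \<tau> = concat (map (\<lambda>(k, b). map (\<lambda>(l, c). (k * l, c)) (\<tau> b)) \<alpha>)"

lemma val_scale: "val \<psi> (map (\<lambda>(l, c). (k * l, c)) \<alpha>) = k * val \<psi> \<alpha>"
  by (induction \<alpha>) (auto simp: algebra_simps)

lemma val_bind: "val \<psi> (bind \<alpha> \<tau>) = val (\<lambda>b. val \<psi> (\<tau> b)) \<alpha>"
  by (induction \<alpha>) (auto simp: bind_def val_scale)

lemma val_map: "val \<psi> (map (\<lambda>(k, b). (k, f b)) \<alpha>) = val (\<lambda>b. \<psi> (f b)) \<alpha>"
  by (induction \<alpha>) auto

lemma val_map_scale: "val \<psi> (map (\<lambda>(l, b). (k * l, f b)) \<alpha>) = k * val (\<lambda>b. \<psi> (f b)) \<alpha>"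
  by (induction \<alpha>) (auto simp: algebra_simps)

lemma vec2_vec_of: "vec2 \<alpha> = vec_of (map (\<lambda>(k, p). (k, case p of (c, d) \<Rightarrow> [c, d])) \<alpha>)"
  unfolding vec2_def vec_of_def val_map by (simp add: case_prod_unfold)

lemma lin_vec2:
  assumes "\<And>c d. T [c, d] = vec2 (\<tau> (c, d))"
  shows "lin T (vec2 \<alpha>) = vec2 (bind \<alpha> \<tau>)"
  unfolding vec2_vec_of[of \<alpha>] lin_vec_of val_map
  by (rule ext) (auto simp: vec2_def val_bind assms intro!: val_cong split: prod.split)

lemma delta2: "delta [c, d] M = (if length M = 2 \<and> M ! 0 = c \<and> M ! 1 = d then 1 else 0)"
  by (auto simp: delta_def length_Suc_conv numeral_2_eq_2)

text \<open>A coefficient function written as a sum of point masses and inserted at one place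
  becomes a combination of basis words.\<close>

lemma replace_at_val:
  "replace_at [c, d] 0 (\<lambda>b. val (\<lambda>x. if b = x then 1 else 0) \<alpha>) M = val (\<lambda>x. delta [x, d] M) \<alpha>"
  "replace_at [c, d] (Suc 0) (\<lambda>b. val (\<lambda>x. if b = x then 1 else 0) \<alpha>) M = val (\<lambda>x. delta [c, x] M) \<alpha>"
proof -
  show "replace_at [c, d] 0 (\<lambda>b. val (\<lambda>x. if b = x then 1 else 0) \<alpha>) M = val (\<lambda>x. delta [x, d] M) \<alpha>"
  proof (cases "length M = 2 \<and> M ! 1 = d")
    case True
    then show ?thesis by (auto simp: replace_at_def delta2 less_Suc_eq numeral_2_eq_2 intro!: val_cong)
  next
    case False
    then show ?thesis
      by (auto simp: replace_at_def delta2 less_Suc_eq numeral_2_eq_2 intro!: val_eq_0[symmetric])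
  qed
  show "replace_at [c, d] (Suc 0) (\<lambda>b. val (\<lambda>x. if b = x then 1 else 0) \<alpha>) M = val (\<lambda>x. delta [c, x] M) \<alpha>"
  proof (cases "length M = 2 \<and> M ! 0 = c")
    case True
    then show ?thesis by (auto simp: replace_at_def delta2 less_Suc_eq numeral_2_eq_2 intro!: val_cong)
  next
    case False
    then show ?thesis
      by (auto simp: replace_at_def delta2 less_Suc_eq numeral_2_eq_2 intro!: val_eq_0[symmetric])
  qed
qed

lemma e_act_coeff: "ecoef i c = (\<lambda>b. val (\<lambda>x. if b = x then 1 else 0) (e_act i c))"
  by (cases c) (auto simp: ecoef_def e_act_def)

lemma f_act_coeff: "fcoef i c = (\<lambda>b. val (\<lambda>x. if b = x then 1 else 0) (f_act i c))"
  by (cases c) (auto simp: fcoef_def f_act_def)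

lemma eT_pair: "eT i [c, d] = vec2 (e_act2 i (c, d))"
  by (rule ext) (simp add: eT_def numeral_2_eq_2 e_act_coeff replace_at_val vec2_def e_act2_def
      val_map val_map_scale)

lemma fT_pair: "fT i [c, d] = vec2 (f_act2 i (c, d))"
proof
  fix M
  have "{0<..<length [c, d]} = {1}" "{Suc 0<..<length [c, d]} = {}" by auto
  then show "fT i [c, d] M = vec2 (f_act2 i (c, d)) M"
    by (simp add: fT_def numeral_2_eq_2 f_act_coeff replace_at_val vec2_def f_act2_def
      val_map val_map_scale)
qed

lemma shiftT_pair: "shiftT b [c, d] = vec2 [(1, zshift b c, zshift b d)]"
  by (cases c; cases d) (simp add: shiftT_def vec2_def)

lemma zsumT_pair: "zsumT [c, d] = vec2 [(1, zshift 1 c, d), (1, c, zshift 1 d)]"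
  by (rule ext) (simp add: zsumT_def numeral_2_eq_2 vec2_def delta_def zshift_def)

lemma qhT_pair: "qhT h [c, d] = vec2 [(qq powi qh_weight h (c, d), c, d)]"
  by (cases h) (auto simp: qhT_def numeral_2_eq_2 vec2_def delta_def qh_weight_def fun_eq_iff algebra_simps)

text \<open>The space \<open>N\<close> lies in the common kernel of all functionals that annihilate the
  vectors \<open>grel c d\<close>; the transposed operators preserve this set of functionals.\<close>

lemma annihilated_lin:
  assumes "\<exists>\<alpha>. x = vec2 \<alpha> \<and> (\<forall>\<psi>. annihilates \<psi> \<longrightarrow> val \<psi> \<alpha> = 0)"
    and "\<And>c d. T [c, d] = vec2 (\<tau> (c, d))"
    and "\<And>\<psi>. annihilates \<psi> \<Longrightarrow> annihilates (\<lambda>p. val \<psi> (\<tau> p))"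
  shows "\<exists>\<alpha>. lin T x = vec2 \<alpha> \<and> (\<forall>\<psi>. annihilates \<psi> \<longrightarrow> val \<psi> \<alpha> = 0)"
proof -
  obtain \<alpha> where "x = vec2 \<alpha>" "\<And>\<psi>. annihilates \<psi> \<Longrightarrow> val \<psi> \<alpha> = 0" using assms(1) by blast
  then have "lin T x = vec2 (bind \<alpha> \<tau>) \<and> (\<forall>\<psi>. annihilates \<psi> \<longrightarrow> val \<psi> (bind \<alpha> \<tau>) = 0)"
    using assms(3) by (simp add: lin_vec2[of T \<tau>, OF assms(2)] val_bind)
  then show ?thesis by blast
qed

lemma Nsp_annihilated: "x \<in> Nsp \<Longrightarrow> \<exists>\<alpha>. x = vec2 \<alpha> \<and> (\<forall>\<psi>. annihilates \<psi> \<longrightarrow> val \<psi> \<alpha> = 0)"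
proof (induction rule: Nsp.induct)
  case base
  \<comment> \<open>The generating vector is itself the relation of a bad pair.\<close>
  have "grel (0, 0) (0, 0) = [(1, (0, 0), (0, 0))]" "bad (0, 0) (0, 0)"
    by (simp_all add: grel_def Crel_def Henergy_def bad_def)
  then have "annihilates \<psi> \<Longrightarrow> val \<psi> [(1, (0, 0), (0, 0))] = 0" for \<psi>
    unfolding annihilates_def by metis
  moreover have "delta [(0, 0), (0, 0)] = vec2 [(1, (0, 0), (0, 0))]" by (simp add: vec2_def)
  ultimately show ?case by blast
next
  case zero
  have "(\<lambda>M. 0) = vec2 []" "val \<psi> [] = 0" for \<psi> :: "bas \<times> bas \<Rightarrow> K" by (simp_all add: vec2_def)
  then show ?case by blast
next
  case (add x y)
  then obtain \<alpha> \<beta> where x: "x = vec2 \<alpha>" "\<And>\<psi>. annihilates \<psi> \<Longrightarrow> val \<psi> \<alpha> = 0"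
    and y: "y = vec2 \<beta>" "\<And>\<psi>. annihilates \<psi> \<Longrightarrow> val \<psi> \<beta> = 0" by metis
  have "(\<lambda>M. x M + y M) = vec2 (\<alpha> @ \<beta>)" "annihilates \<psi> \<Longrightarrow> val \<psi> (\<alpha> @ \<beta>) = 0" for \<psi>
    using x y by (simp_all add: vec2_def)
  then show ?case by blast
next
  case (smult x c)
  then obtain \<alpha> where x: "x = vec2 \<alpha>" "\<And>\<psi>. annihilates \<psi> \<Longrightarrow> val \<psi> \<alpha> = 0" by metis
  have "(\<lambda>M. c * x M) = vec2 (map (\<lambda>(l, b). (c * l, b)) \<alpha>)"
    "annihilates \<psi> \<Longrightarrow> val \<psi> (map (\<lambda>(l, b). (c * l, b)) \<alpha>) = 0" for \<psi>
    using x by (simp_all only: vec2_def val_scale)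
  then show ?case by blast
next
  case (e_op x i)
  show ?case
    by (rule annihilated_lin[OF e_op.IH, where \<tau> = "e_act2 i"])
      (use e_op.hyps(2) in \<open>simp_all add: eT_pair annihilates_e\<close>)
next
  case (f_op x i)
  show ?case
    by (rule annihilated_lin[OF f_op.IH, where \<tau> = "f_act2 i"])
      (use f_op.hyps(2) in \<open>simp_all add: fT_pair annihilates_f\<close>)
next
  case (qh_op x h)
  show ?case
    by (rule annihilated_lin[OF qh_op.IH, where \<tau> = "\<lambda>(c, d). [(qq powi qh_weight h (c, d), c, d)]"])
      (use annihilates_qh[of _ h] in \<open>simp_all add: qhT_pair case_prod_unfold\<close>)
next
  case (zz_op x)
  show ?case
    by (rule annihilated_lin[OF zz_op.IH, where \<tau> = "\<lambda>(c, d). [(1, zshift 1 c, zshift 1 d)]"])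
      (use annihilates_shift[of _ 1] in \<open>simp_all add: shiftT_pair case_prod_unfold\<close>)
next
  case (zzinv_op x)
  show ?case
    by (rule annihilated_lin[OF zzinv_op.IH, where \<tau> = "\<lambda>(c, d). [(1, zshift (-1) c, zshift (-1) d)]"])
      (use annihilates_shift[of _ "-1"] in \<open>simp_all add: shiftT_pair case_prod_unfold\<close>)
next
  case (zsum_op x)
  show ?case
    by (rule annihilated_lin[OF zsum_op.IH, where \<tau> = "\<lambda>(c, d). [(1, zshift 1 c, d), (1, c, zshift 1 d)]"])
      (use annihilates_sum in \<open>simp_all add: zsumT_pair case_prod_unfold\<close>)
qed

lemma embed_vec2: "embed u (vec2 \<alpha>) v = vec_of (map (\<lambda>(k, c, d). (k, u @ c # d # v)) \<alpha>)"
proof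
  fix M
  define P where "P \<longleftrightarrow> length M = length u + 2 + length v \<and> take (length u) M = u \<and> drop (length u + 2) M = v"
  have "embed u (vec2 \<alpha>) v M = val (\<lambda>(c, d). if P then delta [c, d] (take 2 (drop (length u) M)) else 0) \<alpha>"
  proof -
    have "embed u (vec2 \<alpha>) v M = (if P then val (\<lambda>(c, d). delta [c, d] (take 2 (drop (length u) M))) \<alpha> else 0)"
      unfolding embed_def vec2_def P_def ..
    then show ?thesis by (simp add: case_prod_unfold)
  qed
  also have "\<dots> = val (\<lambda>(c, d). delta (u @ c # d # v) M) \<alpha>"
  proof (rule val_cong)
    fix k :: K and p :: "bas \<times> bas"
    obtain c d :: bas where p: "p = (c, d)" by (rule prod.exhaust)
    have "(length M = length u + 2 + length v \<and> take (length u) M = u \<and> drop (length u + 2) M = v \<and>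
        take 2 (drop (length u) M) = [c, d]) \<longleftrightarrow> M = u @ c # d # v"
    proof
      assume "length M = length u + 2 + length v \<and> take (length u) M = u \<and> drop (length u + 2) M = v \<and>
        take 2 (drop (length u) M) = [c, d]"
      then have "M = u @ drop (length u) M" "drop (length u) M = [c, d] @ v"
        by (metis append_take_drop_id, metis append_take_drop_id drop_drop add.commute)
      then show "M = u @ c # d # v" by simp
    qed simp
    then show "(case p of (c, d) \<Rightarrow> if P then delta [c, d] (take 2 (drop (length u) M)) else 0)
      = (case p of (c, d) \<Rightarrow> delta (u @ c # d # v) M)"
      by (auto simp: p delta_def P_def)
  qed
  also have "\<dots> = vec_of (map (\<lambda>(k, c, d). (k, u @ c # d # v)) \<alpha>) M"
    using val_map[of "\<lambda>w. delta w M" "\<lambda>(c, d). u @ c # d # v" \<alpha>]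
    by (simp add: vec_of_def case_prod_unfold)
  finally show "embed u (vec2 \<alpha>) v M = vec_of (map (\<lambda>(k, c, d). (k, u @ c # d # v)) \<alpha>) M" .
qed

lemma lin_shiftT: "lin (shiftT b) (vec2 \<alpha>) = vec2 (shift2 b \<alpha>)"
  using lin_vec2[of "shiftT b" "\<lambda>(c, d). [(1, zshift b c, zshift b d)]"]
  by (simp add: shiftT_pair) (simp add: vec2_def val_bind val_shift2 case_prod_unfold)

lemma Nsp_shift2: "vec2 \<alpha> \<in> Nsp \<Longrightarrow> vec2 (shift2 b \<alpha>) \<in> Nsp"
proof (induction b rule: int_induct[of _ 0])
  case (step1 b)
  have "lin (shiftT 1) (vec2 (shift2 b \<alpha>)) = vec2 (shift2 (b + 1) \<alpha>)"
    by (simp add: lin_shiftT shift2_shift2)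
  then show ?case using Nsp.zz_op[OF step1(2)[OF step1(3)]] by simp
next
  case (step2 b)
  have "lin (shiftT (-1)) (vec2 (shift2 b \<alpha>)) = vec2 (shift2 (b - 1) \<alpha>)"
    by (simp add: lin_shiftT shift2_shift2)
  then show ?case using Nsp.zzinv_op[OF step2(2)[OF step2(3)]] by simp
qed simp

text \<open>The converse inclusion: the nine generators are reached from v_0 \<otimes> v_0 by e_0
  and f_1, dividing by nonzero quantum integers, and the remaining relations by x + y and x
  y.\<close>

lemma vec2_grel_Nsp: "bad c d \<Longrightarrow> vec2 (grel c d) \<in> Nsp"
proof (induction rule: bad_induct)
  case (base i j)
  \<comment> \<open>Vanishing of [2], [3] or [4] would make the power of \<open>qq\<close> with
    exponent 4, 6 or 8 equal to 1.\<close>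
  have 1: "1 + qq^2 \<noteq> 0"
    using qq_power_neq_1[of 4] by (auto simp: eval_nat_numeral add_eq_0_iff)
  have 2: "1 + qq^2 + qq^4 \<noteq> 0"
  proof
    assume "1 + qq^2 + qq^4 = 0"
    then have "(qq^2 - 1) * (1 + qq^2 + qq^4) = 0" by simp
    then show False using qq_power_neq_1[of 6] by (simp add: eval_nat_numeral algebra_simps)
  qed
  have 3: "1 + qq^2 + qq^4 + qq^6 \<noteq> 0"
  proof
    assume "1 + qq^2 + qq^4 + qq^6 = 0"
    then have "(qq^2 - 1) * (1 + qq^2 + qq^4 + qq^6) = 0" by simp
    then show False using qq_power_neq_1[of 8] by (simp add: eval_nat_numeral algebra_simps)
  qed
  have lead: "grel (0, 0) (0, 1) = Crel 0 1" "grel (1, 1) (0, 0) = Crel 1 0" "grel (0, 0) (0, 2) = Crel 0 2"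
    "grel (1, 1) (0, 1) = Crel 1 1" "grel (2, 2) (0, 0) = Crel 2 0" "grel (0, 1) (0, 2) = Crel 1 2"
    "grel (1, 2) (0, 1) = Crel 2 1" "grel (0, 2) (0, 2) = Crel 2 2"
    "grel (2, 2) (1, 1) = shift2 1 (Crel 2 1)"
    by (simp_all add: grel_def Henergy_def)
  \<comment> \<open>Taking the coefficient at \<open>M\<close> as the functional makes the
    identities for \<open>Crel\<close> applicable.\<close>
  have e: "lin (eT i) (vec2 \<alpha>) = (\<lambda>M. val (\<lambda>p. val (\<lambda>(c, d). delta [c, d] M) (e_act2 i p)) \<alpha>)"
    and f: "lin (fT i) (vec2 \<alpha>) = (\<lambda>M. val (\<lambda>p. val (\<lambda>(c, d). delta [c, d] M) (f_act2 i p)) \<alpha>)" for i \<alpha>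
    by (simp_all add: lin_vec2[of _ "e_act2 i"] eT_pair lin_vec2[of _ "f_act2 i"] fT_pair, simp_all add: vec2_def val_bind)
  have scaled: "vec2 \<beta> \<in> Nsp" if "x \<in> Nsp" "x = (\<lambda>M. k * vec2 \<beta> M)" "k \<noteq> 0" for x k \<beta>
    using Nsp.smult[OF that(1), of "inverse k"] that(2,3) by (simp flip: mult.assoc)
  have 00: "vec2 (Crel 0 0) \<in> Nsp" using Nsp.base by (simp add: Crel_def vec2_def)
  have 01: "vec2 (Crel 0 1) \<in> Nsp"
    by (rule scaled[OF Nsp.f_op[OF 00, of 1], where k = 1]) (simp_all only: f f1_Crel, simp_all add: lead vec2_def del: One_nat_def)
  have 10: "vec2 (Crel 1 0) \<in> Nsp"
    by (rule scaled[OF Nsp.e_op[OF 00, of 0], where k = 1]) (simp_all only: e e0_Crel, simp_all add: lead vec2_def del: One_nat_def)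
  have 02: "vec2 (Crel 0 2) \<in> Nsp"
    by (rule scaled[OF Nsp.f_op[OF 01, of 1], where k = "(1 + qq^2) / qq"]) (simp_all only: f f1_Crel, simp_all add: lead vec2_def 1 del: One_nat_def)
  have 11: "vec2 (Crel 1 1) \<in> Nsp"
    by (rule scaled[OF Nsp.f_op[OF 10, of 1], where k = 1]) (simp_all only: f f1_Crel, simp_all add: lead vec2_def del: One_nat_def)
  have 20: "vec2 (Crel 2 0) \<in> Nsp"
    by (rule scaled[OF Nsp.e_op[OF 10, of 0], where k = "(1 + qq^2) / qq"]) (simp_all only: e e0_Crel, simp_all add: lead vec2_def 1 del: One_nat_def)
  have 12: "vec2 (Crel 1 2) \<in> Nsp"
    by (rule scaled[OF Nsp.f_op[OF 02, of 1], where k = "(1 + qq^2 + qq^4) / qq^2"]) (simp_all only: f f1_Crel, simp_all add: lead vec2_def 2 del: One_nat_def)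
  have 22: "vec2 (Crel 2 2) \<in> Nsp"
    by (rule scaled[OF Nsp.f_op[OF 12, of 1], where k = "(1 + qq^2 + qq^4 + qq^6) / qq^3"]) (simp_all only: f f1_Crel, simp_all add: lead vec2_def 3 del: One_nat_def)
  \<comment> \<open>Here e_0 yields \<open>Crel 2 1\<close> multiplied by x y; the inverse shift
    removes that factor.\<close>
  have "lin (eT 0) (vec2 (Crel 2 0)) = (\<lambda>M. (1 + qq^2 + qq^4) / qq^2 * vec2 (shift2 1 (Crel 2 1)) M)"
    by (simp only: e e0_Crel, simp add: lead vec2_def del: One_nat_def)
  from scaled[OF Nsp.e_op[OF 20, of 0] this]
  have "vec2 (shift2 1 (Crel 2 1)) \<in> Nsp" using 2 by simp
  from Nsp_shift2[OF this, of "-1"] have 21: "vec2 (Crel 2 1) \<in> Nsp" by (simp add: shift2_shift2)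
  have "i \<in> {0, 1, 2}" "j \<in> {0, 1, 2}" using base by auto
  then show ?case unfolding grel_base[OF base]
    using 00 01 02 10 11 12 20 21 22 by (elim insertE emptyE; hypsubst) assumption+
next
  case (sum c d)
  have "lin zsumT (vec2 (grel c d)) = vec2 (esum (grel c d))"
    using lin_vec2[of zsumT "\<lambda>(c, d). [(1, zshift 1 c, d), (1, c, zshift 1 d)]"]
    by (simp add: zsumT_pair) (simp add: vec2_def val_bind val_esum case_prod_unfold)
  then show ?case using Nsp.zsum_op[OF sum(2)] grel_esum[OF sum(1)] by simp
next
  case (shift b c d)
  then show ?case by (simp add: grel_shift Nsp_shift2)
qed

text \<open>With the letters on both sides fixed, \<phi> becomes a functional on pairs that
  annihilates the relations, hence N by \<open>Nsp_annihilated\<close>. So \<phi> vanishes on the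
  spanning vectors of \<open>NN n\<close>.\<close>

lemma NN_vec_of:
  assumes "x \<in> NN n" "\<And>u c d v. bad c d \<Longrightarrow> val (\<lambda>(x, y). \<phi> (u @ x # y # v)) (grel c d) = 0"
  shows "\<exists>\<alpha>. x = vec_of \<alpha> \<and> val \<phi> \<alpha> = 0"
  using assms(1)
proof (induction rule: NN.induct)
  case zero
  have "(\<lambda>M. 0) = vec_of []" "val \<phi> [] = 0" by (simp_all add: vec_of_def)
  then show ?case by blast
next
  case (add x y)
  then obtain \<alpha> \<beta> where "x = vec_of \<alpha>" "val \<phi> \<alpha> = 0" "y = vec_of \<beta>" "val \<phi> \<beta> = 0" by blast
  then have "(\<lambda>M. x M + y M) = vec_of (\<alpha> @ \<beta>)" "val \<phi> (\<alpha> @ \<beta>) = 0"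
    by (simp_all add: vec_of_def)
  then show ?case by blast
next
  case (smult x c)
  then obtain \<alpha> where "x = vec_of \<alpha>" "val \<phi> \<alpha> = 0" by blast
  then have "(\<lambda>M. c * x M) = vec_of (map (\<lambda>(l, b). (c * l, b)) \<alpha>)"
    "val \<phi> (map (\<lambda>(l, b). (c * l, b)) \<alpha>) = 0"
    by (simp_all only: vec_of_def val_scale mult_zero_right)
  then show ?case by blast
next
  case (gen w xs ys)
  obtain \<alpha> where \<alpha>: "w = vec2 \<alpha>" "\<And>\<psi>. annihilates \<psi> \<Longrightarrow> val \<psi> \<alpha> = 0"
    using Nsp_annihilated[OF gen(1)] by blast
  have "annihilates (\<lambda>(x, y). \<phi> (xs @ x # y # ys))"
    unfolding annihilates_def using assms(2) by blast
  then have "val \<phi> (map (\<lambda>(k, c, d). (k, xs @ c # d # ys)) \<alpha>) = 0"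
    using \<alpha>(2) val_map[of \<phi> "\<lambda>(c, d). xs @ c # d # ys" \<alpha>] by (simp add: case_prod_unfold)
  then show ?case using \<alpha>(1) embed_vec2 by blast
qed

lemma NO_irreducible: "L \<in> NO n \<Longrightarrow> \<not> wedge.reducible L"
proof
  assume L: "L \<in> NO n" and "wedge.reducible L"
  then obtain u c d v where "L = u @ c # d # v" "bad c d" unfolding wedge.reducible_def by blast
  moreover have "Suc r < length L \<Longrightarrow> Henergy (L ! r) (L ! Suc r) > 0" for r
    using L by (simp add: NO_def normally_ordered_def)
  ultimately show False by (force simp: bad_def nth_append dest: spec[of _ "length u"])
qed

lemma not_NO_reducible:
  assumes "length L = n" "valid L" "L \<notin> NO n"
  obtains u c d v where "L = u @ c # d # v" "bad c d"
proof -
  obtain r where r: "Suc r < length L" "Henergy (L ! r) (L ! Suc r) \<le> 0"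
    using assms by (auto simp: NO_def normally_ordered_def not_less)
  have "L = take r L @ L ! r # L ! Suc r # drop (Suc (Suc r)) L"
    using r(1) by (metis Cons_nth_drop_Suc Suc_lessD append_take_drop_id)
  moreover have "bad (L ! r) (L ! Suc r)"
    using assms(2) r by (simp add: bad_def valid_def)
  ultimately show ?thesis using that by blast
qed

section \<open>Normally ordered wedges\<close>

definition NO_spanned :: "nat \<Rightarrow> vec set" where
  "NO_spanned n = {f. \<exists>\<beta>. snd ` set \<beta> \<subseteq> NO n \<and> (\<lambda>M. f M - vec_of \<beta> M) \<in> NN n}"

lemma NO_spanned_add:
  assumes "f \<in> NO_spanned n" "g \<in> NO_spanned n"
  shows "(\<lambda>M. f M + g M) \<in> NO_spanned n"
proof -
  obtain \<alpha> \<beta> where a: "snd ` set \<alpha> \<subseteq> NO n" "(\<lambda>M. f M - vec_of \<alpha> M) \<in> NN n"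
    and b: "snd ` set \<beta> \<subseteq> NO n" "(\<lambda>M. g M - vec_of \<beta> M) \<in> NN n"
    using assms unfolding NO_spanned_def by blast
  have "(\<lambda>M. (f M + g M) - vec_of (\<alpha> @ \<beta>) M) \<in> NN n"
    using NN.add[OF a(2) b(2)] by (simp add: vec_of_def algebra_simps)
  moreover have "snd ` set (\<alpha> @ \<beta>) \<subseteq> NO n" using a b by auto
  ultimately show ?thesis unfolding NO_spanned_def by blast
qed

lemma NO_spanned_smult:
  assumes "f \<in> NO_spanned n"
  shows "(\<lambda>M. c * f M) \<in> NO_spanned n"
proof -
  obtain \<alpha> where a: "snd ` set \<alpha> \<subseteq> NO n" "(\<lambda>M. f M - vec_of \<alpha> M) \<in> NN n"
    using assms unfolding NO_spanned_def by blast
  have "(\<lambda>M. c * f M - vec_of (map (\<lambda>(l, b). (c * l, b)) \<alpha>) M) \<in> NN n"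
    using NN.smult[OF a(2), of c] by (simp only: vec_of_def val_scale right_diff_distrib)
  moreover have "snd ` set (map (\<lambda>(l, b). (c * l, b)) \<alpha>) \<subseteq> NO n" using a by force
  ultimately show ?thesis unfolding NO_spanned_def by blast
qed

lemma NO_spanned_NN: "f \<in> NN n \<Longrightarrow> f \<in> NO_spanned n"
  unfolding NO_spanned_def by (auto simp: vec_of_def intro!: exI[of _ "[]"])

lemma NO_spanned_vec_of:
  "(\<And>k w. (k, w) \<in> set \<alpha> \<Longrightarrow> delta w \<in> NO_spanned n) \<Longrightarrow> vec_of \<alpha> \<in> NO_spanned n"
proof (induction \<alpha>)
  case Nil
  then show ?case using NO_spanned_NN[OF NN.zero] by (simp add: vec_of_def)
next
  case (Cons p \<alpha>)
  obtain k w where p: "p = (k, w)" by (rule prod.exhaust)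
  have "delta w \<in> NO_spanned n" "vec_of \<alpha> \<in> NO_spanned n" using Cons by (auto simp: p)
  from NO_spanned_add[OF NO_spanned_smult[OF this(1), of k] this(2)]
  show ?case by (simp add: vec_of_def p)
qed

text \<open>Rewriting terminates: modulo \<open>NN n\<close> a word with a bad pair equals minus the
  tail of the embedded relation, whose words are smaller and still valid.\<close>

lemma delta_NO_spanned: "length L = n \<Longrightarrow> valid L \<Longrightarrow> delta L \<in> NO_spanned n"
proof (induction L rule: wf_induct_rule[OF wf_word_less])
  case (1 L)
  show ?case
  proof (cases "L \<in> NO n")
    case True
    then have "snd ` set [(1 :: K, L)] \<subseteq> NO n" "(\<lambda>M. delta L M - vec_of [(1, L)] M) \<in> NN n"
      using NN.zero by (simp_all add: vec_of_def)
    then show ?thesis unfolding NO_spanned_def by blast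
  next
    case False
    then obtain u c d v where L: "L = u @ c # d # v" "bad c d"
      using not_NO_reducible 1 by metis
    obtain r where r: "grel c d = (1, c, d) # r" "\<forall>(k, c', d') \<in> set r. lower c d c' d'"
      using grel_lead[OF L(2)] by blast
    let ?r = "map (\<lambda>(k, c, d). (k, u @ c # d # v)) r"
    have "embed u (vec2 (grel c d)) v \<in> NN n"
      using 1 L by (intro NN.gen vec2_grel_Nsp) (auto simp: valid_def)
    then have "embed u (vec2 (grel c d)) v \<in> NO_spanned n" by (rule NO_spanned_NN)
    moreover have "vec_of ?r \<in> NO_spanned n"
    proof (rule NO_spanned_vec_of)
      fix k w assume "(k, w) \<in> set ?r"
      then obtain c' d' where w: "(k, c', d') \<in> set r" "w = u @ c' # d' # v" by auto
      then have low: "lower c d c' d'" using r(2) by blast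
      show "delta w \<in> NO_spanned n"
      proof (rule 1(1))
        show "(w, L) \<in> word_less"
          using wedge.context2[OF lower_word_less[OF low]] by (simp add: w L)
        show "length w = n" using 1 L w by simp
        show "valid w" using 1(3) low by (auto simp: L w valid_def lower_def)
      qed
    qed
    ultimately have "(\<lambda>M. embed u (vec2 (grel c d)) v M + (-1) * vec_of ?r M) \<in> NO_spanned n"
      by (intro NO_spanned_add NO_spanned_smult)
    moreover have "(\<lambda>M. embed u (vec2 (grel c d)) v M + (-1) * vec_of ?r M) = delta L"
      by (simp add: embed_vec2 r(1) vec_of_def L)
    ultimately show ?thesis by simp
  qed
qed

theorem mainTheorem4:
  fixes n :: nat
  assumes "0 < n"
  shows "(\<forall>f\<in>Tn n. \<exists>S c. finite S \<and> S \<subseteq> NO n \<and>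
            (\<lambda>M. f M - (\<Sum>L\<in>S. c L * delta L M)) \<in> NN n)
       \<and> (\<forall>S c. finite S \<and> S \<subseteq> NO n \<and> (\<lambda>M. \<Sum>L\<in>S. c L * delta L M) \<in> NN n
            \<longrightarrow> (\<forall>L\<in>S. c L = (0::K)))"
proof (intro conjI ballI allI impI)
  fix f assume f: "f \<in> Tn n"
  obtain ws where ws: "set ws = {L. f L \<noteq> 0}" "distinct ws"
    using f finite_distinct_list unfolding Tn_def by blast
  have "f = vec_of (map (\<lambda>w. (f w, w)) ws)"
  proof
    fix M
    have "vec_of (map (\<lambda>w. (f w, w)) ws) M = (\<Sum>w\<leftarrow>ws. f w * delta w M)"
      by (simp add: vec_of_def val_def o_def)
    also have "\<dots> = (\<Sum>w\<in>{L. f L \<noteq> 0}. f w * delta w M)"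
      using ws by (simp add: sum_list_distinct_conv_sum_set)
    also have "\<dots> = f M"
      using f by (simp add: Tn_def delta_def if_distrib[of "\<lambda>x. _ * x"] cong: if_cong)
    finally show "f M = vec_of (map (\<lambda>w. (f w, w)) ws) M" by simp
  qed
  moreover have "vec_of (map (\<lambda>w. (f w, w)) ws) \<in> NO_spanned n"
    using f ws by (intro NO_spanned_vec_of) (auto simp: Tn_def intro: delta_NO_spanned)
  ultimately obtain \<beta> where \<beta>: "snd ` set \<beta> \<subseteq> NO n" "(\<lambda>M. f M - vec_of \<beta> M) \<in> NN n"
    unfolding NO_spanned_def by auto
  \<comment> \<open>Repeated words of \<beta> are merged; the total coefficients
    \<open>vec_of \<beta> L\<close> are the witness for \<open>c\<close>.\<close>
  have "vec_of \<beta> M = (\<Sum>L\<in>snd ` set \<beta>. vec_of \<beta> L * delta L M)" for M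
    by (subst vec_of_def) (rule val_vec_of; simp)
  note eq = this[symmetric]
  have "(\<lambda>M. f M - (\<Sum>L\<in>snd ` set \<beta>. vec_of \<beta> L * delta L M)) \<in> NN n"
    unfolding eq by (rule \<beta>(2))
  then show "\<exists>S c. finite S \<and> S \<subseteq> NO n \<and> (\<lambda>M. f M - (\<Sum>L\<in>S. c L * delta L M)) \<in> NN n"
    using \<beta>(1) by (intro exI conjI) auto
next
  fix S c L
  assume "finite S \<and> S \<subseteq> NO n \<and> (\<lambda>M. \<Sum>L\<in>S. c L * delta L M) \<in> NN n" and L: "L \<in> S"
  then have S: "finite S" "S \<subseteq> NO n" "(\<lambda>M. \<Sum>L\<in>S. c L * delta L M) \<in> NN n" by auto
  \<comment> \<open>The diamond lemma supplies a functional on the quotient that is dual to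
    \<open>L\<close> among the irreducible words.\<close>
  obtain \<phi> where \<phi>: "\<And>w. \<not> wedge.reducible w \<Longrightarrow> \<phi> w = (if w = L then 1 else 0)"
    and kills: "\<And>u c d v. bad c d \<Longrightarrow> val (\<lambda>(x, y). \<phi> (u @ x # y # v)) (grel c d) = 0"
    using wedge.diamond[of "\<lambda>w. if w = L then 1 else 0"] by blast
  obtain \<alpha> where \<alpha>: "(\<lambda>M. \<Sum>L\<in>S. c L * delta L M) = vec_of \<alpha>" "val \<phi> \<alpha> = 0"
    using NN_vec_of[OF S(3) kills] by blast
  have vec: "vec_of \<alpha> M = (if M \<in> S then c M else 0)" for M
    using S(1) by (simp add: delta_def if_distrib[of "\<lambda>x. _ * x"] flip: \<alpha>(1) cong: if_cong)
  \<comment> \<open>The set is enlarged to contain all words of \<alpha>, as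
    \<open>val_vec_of\<close> demands; words outside \<open>S\<close> have coefficient 0 and drop
    out again.\<close>
  have "0 = (\<Sum>M\<in>S \<union> snd ` set \<alpha>. vec_of \<alpha> M * \<phi> M)"
    using val_vec_of[of "S \<union> snd ` set \<alpha>" \<alpha> \<phi>] S(1) \<alpha>(2) by simp
  also have "\<dots> = (\<Sum>M\<in>S. c M * \<phi> M)"
    using S(1) by (intro sum.mono_neutral_cong_right) (auto simp: vec)
  also have "\<dots> = (\<Sum>M\<in>S. c M * (if M = L then 1 else 0))"
    using S(2) NO_irreducible \<phi> by (intro sum.cong) auto
  also have "\<dots> = c L" using S(1) L by (simp add: if_distrib[of "\<lambda>x. _ * x"] cong: if_cong)
  finally show "c L = 0" by simp
qed

end
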